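(* For every even integer $n>0$ and every odd integer $m>n$, there exists a Runge--Kutta scheme belonging to $\mathrm{EES}(n,m)$.
   Context: Trees and Hopf algebra. $\mathcal{T}$ is the set of (isomorphism classes of) finite unlabelled non-planar rooted trees, including the empty tree $\emptyset$; $|\tau|$ is the number of vertices, $\bullet$ the one-vertex tree, and $[\tau_1,\ldots,\tau_k]$ the tree obtained by joining the roots of $\tau_1,\ldots,\tau_k$ to a new root. The tree factorial is $\emptyset!=\bullet!=1$, $[\tau_1,\ldots,\tau_k]!=|[\tau_1,\ldots,\tau_k]|\,\tau_1!\cdots\tau_k!$. $\mathcal{H}$ is the free commutative $\mathbb{R}$-algebra on the non-empty trees (linear basis: forests; product $\mu$: juxtaposition; unit: $\emptyset$), graded by the total number $|\cdot|$ of vertices. It is the Butcher--Connes--Kreimer Hopf algebra: $\varepsilon(\emptyset)=1$, $\varepsilon(\tau)=0$ for non-empty $\tau$; $\Delta(\tau)=\tau\otimes\emptyset+\emptyset\otimes\tau+\sum_c P_c(\tau)\otimes R_c(\tau)$ for a non-empty tree $\tau$, the sum running over non-empty sets $c$ of edges such that each path from the root to a leaf meets at most one edge of $c$, where $R_c(\tau)$ is the component containing the root after deleting $c$ and $P_c(\tau)$ the forest of the other components; $\Delta$ is extended as an algebra morphism, and $S$ is the antipode. The maps $(\cdot)^\pm$. Let $\mathrm{Id}^{1/2}:\mathcal{H}\to\mathcal{H}$ be the unique unital algebra endomorphism with $\mu\circ(\mathrm{Id}^{1/2}\otimes\mathrm{Id}^{1/2})\circ\Delta=\mathrm{Id}$,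 and $\bar S(\tau)=(-1)^{|\tau|}S(\tau)$ on forests. Define linear maps on $\mathcal{H}$ by $\tau^-=\mu\circ(\bar S\otimes\mathrm{Id})\circ\Delta\circ\mathrm{Id}^{1/2}(\tau)$ and $\tau^+=\mu\circ(\mathrm{Id}\otimes((\cdot)^-\circ S))\circ\Delta(\tau)$. Runge--Kutta schemes. An $s$-stage Runge--Kutta (RK) scheme $\Psi$ is given by real coefficients $A=(a_{ij})_{1\le i,j\le s}$, $b=(b_i)_{1\le i\le s}$; it is explicit if $a_{ij}=0$ for $j\ge i$. All schemes are assumed consistent: $\sum_i b_i=1$. Its elementary weights function $\psi$ is the unital algebra homomorphism $\mathcal{H}\to\mathbb{R}$ given on non-empty trees by $\psi([\tau_1,\ldots,\tau_k])=\sum_i b_i\prod_{l=1}^k\psi_i(\tau_l)$, where $\psi_i([\tau_1,\ldots,\tau_k])=\sum_j a_{ij}\prod_{l=1}^k\psi_j(\tau_l)$ (for $\bullet$, $k=0$ and empty products are $1$). Orders. $\mathrm{ord}(\psi)=\sup\{n\in\mathbb{N}:\psi(\tau)=1/\tau!\ \text{for all trees } |\tau|\le n\}$; antisymmetric order $\mathrm{ord}^+(\psi)=\sup\{n\in\mathbb{N}:\psi(\tau^+)=0\ \text{for all trees } \tau \text{ with } 1\le|\tau|\le n\}$. $\mathrm{EES}(n,m)$ is the class of explicit RK schemes with $\mathrm{ord}(\psi)=n$ and $\mathrm{ord}^+(\psi)=m$. *)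

theory Defs
  imports
    Complex_Main
    "HOL-Library.Extended_Nat"
    "HOL-Library.FuncSet"
    "HOL-Library.Multiset"
    "HOL-Library.Poly_Mapping"
    "HOL-Library.Product_Plus"
    "HOL-Library.Sublist"
begin

section \<open>Rooted trees\<close>

text \<open>
  The type \<open>rtree\<close> consists of the non-empty trees: \<open>Node {#t\<^sub>1, \<dots>, t\<^sub>k#}\<close> is
  \<open>[t\<^sub>1, \<dots>, t\<^sub>k]\<close>. A forest is a multiset of such trees; the empty tree is the empty
  forest.
\<close>

datatype rtree = Node "rtree multiset"

type_synonym forest = "rtree multiset"

primrec vertices :: "rtree \<Rightarrow> nat" where
  "vertices (Node M) = Suc (\<Sum>\<^sub># (image_mset vertices M))"

definition forest_vertices :: "forest \<Rightarrow> nat" where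
  "forest_vertices F = \<Sum>\<^sub># (image_mset vertices F)"

primrec tree_fact :: "rtree \<Rightarrow> nat" where
  "tree_fact (Node M) = vertices (Node M) * \<Prod>\<^sub># (image_mset tree_fact M)"


section \<open>Free vector spaces\<close>

instantiation poly_mapping :: (type, real_vector) real_vector
begin

lift_definition scaleR_poly_mapping ::
    "real \<Rightarrow> ('a \<Rightarrow>\<^sub>0 'b) \<Rightarrow> 'a \<Rightarrow>\<^sub>0 'b"
  is "\<lambda>r f k. r *\<^sub>R f k"
  by (rule finite_subset) auto

instance
  by standard (transfer; simp add: algebra_simps)+

end

lemma scaleR_poly_mapping_conv_mult:
  fixes x :: "'a::monoid_add \<Rightarrow>\<^sub>0 'b::real_algebra_1"
  shows "a *\<^sub>R x = Poly_Mapping.single 0 (of_real a) * x"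
  by (simp flip: mult_map_scale_conv_mult)
     (rule poly_mapping_eqI, simp add: scaleR_poly_mapping.rep_eq map.rep_eq scaleR_conv_of_real when_def)

instance poly_mapping :: (comm_monoid_add, "{real_algebra_1, comm_ring_1}") real_algebra_1
  by standard (simp_all add: scaleR_poly_mapping_conv_mult mult_ac)

abbreviation basis :: "'a \<Rightarrow> 'a \<Rightarrow>\<^sub>0 real" where
  "basis k \<equiv> Poly_Mapping.single k 1"

text \<open>The linear map with prescribed values on the basis.\<close>

definition lin_ext :: "('a \<Rightarrow> 'b::real_vector) \<Rightarrow> ('a \<Rightarrow>\<^sub>0 real) \<Rightarrow> 'b" where
  "lin_ext f x = (\<Sum>k\<in>Poly_Mapping.keys x. Poly_Mapping.lookup x k *\<^sub>R f k)"


section \<open>The algebra and its tensor square\<close>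

text \<open>
  The library's product of \<open>alg\<close> satisfies \<open>basis F * basis G = basis (F + G)\<close>, which is
  juxtaposition of forests, and \<open>1 = basis {#}\<close> is the empty tree. The tensor square of \<open>alg\<close> has
  the basis \<open>F \<otimes> G = (F, G)\<close>, and its product is the componentwise one.
\<close>

type_synonym alg = "forest \<Rightarrow>\<^sub>0 real"
type_synonym alg2 = "(forest \<times> forest) \<Rightarrow>\<^sub>0 real"

definition unital_alg_hom :: "('a::real_algebra_1 \<Rightarrow> 'b::real_algebra_1) \<Rightarrow> bool" where
  "unital_alg_hom f \<longleftrightarrow> linear f \<and> f 1 = 1 \<and> (\<forall>x y. f (x * y) = f x * f y)"

text \<open>The unital algebra homomorphism with prescribed values on the trees.\<close>

definition alg_ext :: "(rtree \<Rightarrow> 'b::{real_algebra_1,comm_ring_1}) \<Rightarrow> alg \<Rightarrow> 'b" where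
  "alg_ext g = lin_ext (\<lambda>F. \<Prod>\<^sub># (image_mset g F))"

definition tensor :: "alg \<Rightarrow> alg \<Rightarrow> alg2" where
  "tensor x y = lin_ext (\<lambda>F. lin_ext (\<lambda>G. basis (F, G)) y) x"

definition tensor_map :: "(alg \<Rightarrow> alg) \<Rightarrow> (alg \<Rightarrow> alg) \<Rightarrow> alg2 \<Rightarrow> alg2" where
  "tensor_map f g = lin_ext (\<lambda>(F, G). tensor (f (basis F)) (g (basis G)))"

definition mu :: "alg2 \<Rightarrow> alg" where
  "mu = lin_ext (\<lambda>(F, G). basis F * basis G)"

definition counit :: "alg \<Rightarrow> real" where
  "counit = alg_ext (\<lambda>t. 0)"


section \<open>Admissible cuts and the coproduct\<close>

text \<open>
  Edges are not visible in a multiset of subtrees, so cuts are taken in a planar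
  representative, whose vertices are addressed by the list of child indices leading to
  them from the root. An edge is identified with its lower end point; the edges on the
  path from the root to \<open>l\<close> are then the non-empty prefixes of \<open>l\<close>. The choice of the
  representative does not matter (\<open>coprod_tree_shape\<close> below).
\<close>

datatype ptree = PNode (children: "ptree list")

primrec shape :: "ptree \<Rightarrow> rtree" where
  "shape (PNode ts) = Node (mset (map shape ts))"

fun is_vertex :: "ptree \<Rightarrow> nat list \<Rightarrow> bool" where
  "is_vertex t [] = True"
| "is_vertex (PNode ts) (i # p) = (i < length ts \<and> is_vertex (ts ! i) p)"

definition edges :: "ptree \<Rightarrow> nat list set" where
  "edges t = {p. is_vertex t p \<and> p \<noteq> []}"

definition leaves :: "ptree \<Rightarrow> nat list set" where
  "leaves t = {p. is_vertex t p \<and> (\<forall>i. \<not> is_vertex t (p @ [i]))}"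

definition admissible :: "ptree \<Rightarrow> nat list set \<Rightarrow> bool" where
  "admissible t c \<longleftrightarrow> c \<subseteq> edges t \<and> (\<forall>l\<in>leaves t. card {e\<in>c. prefix e l} \<le> 1)"

fun subtree :: "ptree \<Rightarrow> nat list \<Rightarrow> ptree" where
  "subtree t [] = t"
| "subtree (PNode ts) (i # p) = subtree (ts ! i) p"

text \<open>The component containing the root after deleting the edges in \<open>c\<close>.\<close>

function trunk :: "ptree \<Rightarrow> nat list set \<Rightarrow> rtree" where
  "trunk (PNode ts) c =
     Node (mset (map (\<lambda>i. trunk (ts ! i) {p. i # p \<in> c})
                     (filter (\<lambda>i. [i] \<notin> c) [0..<length ts])))"
  by pat_completeness auto
termination
  by (relation "measure (size \<circ> fst)") (auto simp: less_Suc_eq_le intro!: size_list_estimation')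

text \<open>
  The forest of the other components: the one hanging below \<open>e \<in> c\<close> contains the root of
  \<open>subtree t e\<close> and is bounded by the edges of \<open>c\<close> below \<open>e\<close> (there are none if \<open>c\<close> is
  admissible).
\<close>

definition pruned :: "ptree \<Rightarrow> nat list set \<Rightarrow> forest" where
  "pruned t c = image_mset (\<lambda>e. trunk (subtree t e) {p. p \<noteq> [] \<and> e @ p \<in> c}) (mset_set c)"

definition planar :: "rtree \<Rightarrow> ptree" where
  "planar \<tau> = (SOME t. shape t = \<tau>)"

definition coprod_tree :: "rtree \<Rightarrow> alg2" where
  "coprod_tree \<tau> =
     tensor (basis {#\<tau>#}) 1 + tensor 1 (basis {#\<tau>#}) +
     (\<Sum>c | admissible (planar \<tau>) c \<and> c \<noteq> {}.
        tensor (basis (pruned (planar \<tau>) c)) (basis {#trunk (planar \<tau>) c#}))"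

definition coprod :: "alg \<Rightarrow> alg2" where
  "coprod = alg_ext coprod_tree"


section \<open>The antipode and the maps plus and minus\<close>

definition convolution :: "(alg \<Rightarrow> alg) \<Rightarrow> (alg \<Rightarrow> alg) \<Rightarrow> alg \<Rightarrow> alg" where
  "convolution f g = mu \<circ> tensor_map f g \<circ> coprod"

definition antipode :: "alg \<Rightarrow> alg" where
  "antipode = (THE S. linear S \<and>
     convolution S id = (\<lambda>x. counit x *\<^sub>R 1) \<and>
     convolution id S = (\<lambda>x. counit x *\<^sub>R 1))"

definition id_half :: "alg \<Rightarrow> alg" where
  "id_half = (THE f. unital_alg_hom f \<and> convolution f f = id)"

definition antipode_bar :: "alg \<Rightarrow> alg" where
  "antipode_bar = lin_ext (\<lambda>F. (-1) ^ forest_vertices F *\<^sub>R antipode (basis F))"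

definition minus_map :: "alg \<Rightarrow> alg" where
  "minus_map = convolution antipode_bar id \<circ> id_half"

definition plus_map :: "alg \<Rightarrow> alg" where
  "plus_map = convolution id (minus_map \<circ> antipode)"


section \<open>Runge--Kutta schemes\<close>

text \<open>Only the coefficients with indices in \<open>{1..stages}\<close> are meaningful.\<close>

record rk_scheme =
  stages :: nat
  rk_a :: "nat \<Rightarrow> nat \<Rightarrow> real"
  rk_b :: "nat \<Rightarrow> real"

definition explicit_rk :: "rk_scheme \<Rightarrow> bool" where
  "explicit_rk \<Psi> \<longleftrightarrow> (\<forall>i\<in>{1..stages \<Psi>}. \<forall>j\<in>{1..stages \<Psi>}. i \<le> j \<longrightarrow> rk_a \<Psi> i j = 0)"

definition consistent_rk :: "rk_scheme \<Rightarrow> bool" where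
  "consistent_rk \<Psi> \<longleftrightarrow> (\<Sum>i = 1..stages \<Psi>. rk_b \<Psi> i) = 1"

primrec stage_weight :: "rk_scheme \<Rightarrow> rtree \<Rightarrow> nat \<Rightarrow> real" where
  "stage_weight \<Psi> (Node M) =
     (\<lambda>i. \<Sum>j = 1..stages \<Psi>. rk_a \<Psi> i j * \<Prod>\<^sub># (image_mset (\<lambda>\<tau>. stage_weight \<Psi> \<tau> j) M))"

primrec tree_weight :: "rk_scheme \<Rightarrow> rtree \<Rightarrow> real" where
  "tree_weight \<Psi> (Node M) =
     (\<Sum>i = 1..stages \<Psi>. rk_b \<Psi> i * \<Prod>\<^sub># (image_mset (\<lambda>\<tau>. stage_weight \<Psi> \<tau> i) M))"

definition elementary_weights :: "rk_scheme \<Rightarrow> alg \<Rightarrow> real" where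
  "elementary_weights \<Psi> = alg_ext (tree_weight \<Psi>)"


section \<open>Orders\<close>

text \<open>
  The suprema are taken in the extended naturals, since an order may be infinite. The
  order condition for the empty tree is \<open>\<psi> 1 = 1\<close>.
\<close>

definition rk_order :: "(alg \<Rightarrow> real) \<Rightarrow> enat" where
  "rk_order \<psi> = Sup {enat n | n. \<psi> 1 = 1 \<and>
     (\<forall>\<tau>. vertices \<tau> \<le> n \<longrightarrow> \<psi> (basis {#\<tau>#}) = 1 / real (tree_fact \<tau>))}"

definition antisym_order :: "(alg \<Rightarrow> real) \<Rightarrow> enat" where
  "antisym_order \<psi> = Sup {enat n | n.
     \<forall>\<tau>. vertices \<tau> \<le> n \<longrightarrow> \<psi> (plus_map (basis {#\<tau>#})) = 0}"

definition EES :: "nat \<Rightarrow> nat \<Rightarrow> rk_scheme set" where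
  "EES n m = {\<Psi>. consistent_rk \<Psi> \<and> explicit_rk \<Psi> \<and>
     rk_order (elementary_weights \<Psi>) = enat n \<and>
     antisym_order (elementary_weights \<Psi>) = enat m}"


section \<open>Well-definedness of the coproduct\<close>

lemma linear_lin_ext: "linear (lin_ext f)"
proof
  have *: "lin_ext f x = (\<Sum>k\<in>A. Poly_Mapping.lookup x k *\<^sub>R f k)"
    if "finite A" "Poly_Mapping.keys x \<subseteq> A" for x A
    unfolding lin_ext_def using that
    by (intro sum.mono_neutral_left) (auto simp: in_keys_iff)
  fix x y :: "'a \<Rightarrow>\<^sub>0 real" and r :: real
  let ?A = "Poly_Mapping.keys x \<union> Poly_Mapping.keys y"
  have "Poly_Mapping.keys (x + y) \<subseteq> ?A" by (rule keys_add)
  then show "lin_ext f (x + y) = lin_ext f x + lin_ext f y"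
    by (simp add: *[of ?A] lookup_add scaleR_add_left sum.distrib)
  have "Poly_Mapping.keys (r *\<^sub>R x) \<subseteq> Poly_Mapping.keys x"
    by (auto simp: in_keys_iff scaleR_poly_mapping.rep_eq)
  then show "lin_ext f (r *\<^sub>R x) = r *\<^sub>R lin_ext f x"
    by (simp add: *[of "Poly_Mapping.keys x"] scaleR_poly_mapping.rep_eq scaleR_sum_right)
qed

lemma lin_ext_basis [simp]: "lin_ext f (basis k) = f k"
  by (simp add: lin_ext_def)

lemma lin_ext_sum: "lin_ext f (sum g A) = (\<Sum>a\<in>A. lin_ext f (g a))"
  by (rule linear_sum[OF linear_lin_ext])

lemma tensor_basis [simp]: "tensor (basis F) (basis G) = basis (F, G)"
  by (simp add: tensor_def)

lemma tensor_basis_one [simp]: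
  "tensor (basis F) 1 = basis (F, {#})" "tensor 1 (basis F) = basis ({#}, F)"
  using tensor_basis[of F "{#}"] tensor_basis[of "{#}" F]
  by (simp_all del: tensor_basis flip: zero_multiset_def single_one)

lemma prod_basis: "(\<Prod>a\<in>A. basis (f a)) = basis (\<Sum>a\<in>A. f a)"
  for f :: "'a \<Rightarrow> 'b::comm_monoid_add"
  by (induction A rule: infinite_finite_induct) (simp_all add: mult_single single_one)

lemma finite_is_vertex: "finite {p. is_vertex t p}"
proof (induction t)
  case (PNode ts)
  have "{p. is_vertex (PNode ts) p} =
      insert [] (\<Union>i<length ts. (#) i ` {p. is_vertex (ts ! i) p})" (is "?L = ?R")
  proof (rule set_eqI)
    fix p show "p \<in> ?L \<longleftrightarrow> p \<in> ?R" by (cases p) auto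
  qed
  then show ?case using PNode by auto
qed

lemma is_vertex_prefix: "is_vertex t q \<Longrightarrow> prefix p q \<Longrightarrow> is_vertex t p"
  by (induction t q arbitrary: p rule: is_vertex.induct) (auto simp: prefix_Cons)

lemma ex_leaf:
  assumes "is_vertex t p"
  obtains l where "l \<in> leaves t" "prefix p l"
proof -
  let ?V = "{q. is_vertex t q \<and> prefix p q}"
  have fin: "finite ?V"
    by (rule finite_subset[OF _ finite_is_vertex[of t]]) blast
  then have finl: "finite (length ` ?V)" by (rule finite_imageI)
  have "p \<in> ?V" using assms by simp
  then have "Max (length ` ?V) \<in> length ` ?V"
    using finl by (intro Max_in) blast+
  then obtain l where l: "Max (length ` ?V) = length l" "l \<in> ?V"
    by (rule imageE)
  have "l \<in> leaves t"
  proof (rule ccontr)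
    assume "l \<notin> leaves t"
    then obtain i where "is_vertex t (l @ [i])" using l by (auto simp: leaves_def)
    then have "l @ [i] \<in> ?V" using l by auto
    then have "length (l @ [i]) \<le> Max (length ` ?V)"
      using finl by (intro Max_ge imageI)
    then show False using l by simp
  qed
  then show ?thesis using l that by blast
qed

definition antichain :: "nat list set \<Rightarrow> bool" where
  "antichain c \<longleftrightarrow> (\<forall>e\<in>c. \<forall>f\<in>c. prefix e f \<longrightarrow> e = f)"

lemma finite_cut: "c \<subseteq> {p. is_vertex t p} \<Longrightarrow> finite c"
  using finite_is_vertex finite_subset by blast

lemma admissible_iff_antichain: "admissible t c \<longleftrightarrow> c \<subseteq> edges t \<and> antichain c"
proof (cases "c \<subseteq> edges t")
  case True
  then have fin: "finite c" by (intro finite_cut[of _ t]) (auto simp: edges_def)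
  have "(\<forall>l\<in>leaves t. card {e\<in>c. prefix e l} \<le> 1) \<longleftrightarrow> antichain c"
  proof
    assume L: "\<forall>l\<in>leaves t. card {e\<in>c. prefix e l} \<le> 1"
    show "antichain c" unfolding antichain_def
    proof (intro ballI impI)
      fix e f assume ef: "e \<in> c" "f \<in> c" "prefix e f"
      then have "is_vertex t f" using True by (auto simp: edges_def)
      then obtain l where l: "l \<in> leaves t" "prefix f l" by (rule ex_leaf)
      have "e \<in> {e\<in>c. prefix e l}" "f \<in> {e\<in>c. prefix e l}"
        using ef l prefix_order.trans by auto
      moreover have "card {e\<in>c. prefix e l} \<le> Suc 0" using L l by auto
      ultimately show "e = f" using fin by (simp add: card_le_Suc0_iff_eq)
    qed
  next
    assume "antichain c"
    then show "\<forall>l\<in>leaves t. card {e\<in>c. prefix e l} \<le> 1"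
      using fin by (auto simp: card_le_Suc0_iff_eq antichain_def) (metis prefix_same_cases)
  qed
  then show ?thesis using True by (simp add: admissible_def)
qed (simp add: admissible_def)

text \<open>Extended cuts may also cut the (imaginary) edge above the root.\<close>

definition ext_cuts :: "ptree \<Rightarrow> nat list set set" where
  "ext_cuts t = {c. c \<subseteq> {p. is_vertex t p} \<and> antichain c}"

definition root_part :: "ptree \<Rightarrow> nat list set \<Rightarrow> forest" where
  "root_part t c = (if [] \<in> c then {#} else {#trunk t c#})"

lemma finite_ext_cuts: "finite (ext_cuts t)"
proof (rule finite_subset)
  show "ext_cuts t \<subseteq> Pow {p. is_vertex t p}" unfolding ext_cuts_def by blast
  show "finite (Pow {p. is_vertex t p})" by (simp only: finite_Pow_iff finite_is_vertex)
qed

lemma ext_cuts_eq: "ext_cuts t = insert {[]} {c. admissible t c}"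
proof (rule set_eqI)
  fix c
  show "c \<in> ext_cuts t \<longleftrightarrow> c \<in> insert {[]} {c. admissible t c}"
  proof (cases "[] \<in> c")
    case True
    have "f = []" if "antichain c" "f \<in> c" for f
      using that(1)[unfolded antichain_def, rule_format, OF True that(2) Nil_prefix] by (rule sym)
    then have "c = {[]}" if "antichain c"
      using that True by blast
    then have "antichain c \<longleftrightarrow> c = {[]}" by (auto simp: antichain_def)
    moreover have "\<not> admissible t c" using True by (auto simp: admissible_def edges_def)
    ultimately show ?thesis by (auto simp: ext_cuts_def)
  next
    case False
    then have "c \<subseteq> edges t \<longleftrightarrow> c \<subseteq> {p. is_vertex t p}" by (auto simp: edges_def)
    then show ?thesis using False by (auto simp: ext_cuts_def admissible_iff_antichain)
  qed
qed

lemma trunk_empty [simp]: "trunk t {} = shape t"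
proof (induction t)
  case (PNode ts)
  then have "map (\<lambda>i. trunk (ts ! i) {}) [0..<length ts] = map shape ts"
    by (intro nth_equalityI) simp_all
  then show ?case by (simp del: mset_map)
qed

lemma sum_ext_cuts:
  "(\<Sum>c\<in>ext_cuts t. basis (pruned t c, root_part t c)) =
     basis ({#shape t#}, {#}) +
     (\<Sum>c | admissible t c. basis (pruned t c, {#trunk t c#}))"
proof -
  have "{c. admissible t c} \<subseteq> ext_cuts t" by (auto simp: ext_cuts_eq)
  then have fin: "finite {c. admissible t c}" using finite_ext_cuts finite_subset by blast
  have "\<not> admissible t {[]}" by (auto simp: admissible_def edges_def)
  moreover have "(\<Sum>c | admissible t c. basis (pruned t c, root_part t c)) =
      (\<Sum>c | admissible t c. basis (pruned t c, {#trunk t c#}))"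
    by (intro sum.cong) (auto simp: root_part_def admissible_def edges_def)
  moreover have "pruned t {[]} = {#shape t#}"
  proof -
    have "{p. p \<noteq> [] \<and> [] @ p \<in> {[]}} = ({} :: nat list set)" by blast
    moreover have "mset_set {[] :: nat list} = {#[]#}" by simp
    ultimately show ?thesis
      by (simp only: pruned_def image_mset_single subtree.simps trunk_empty)
  qed
  moreover have "root_part t {[]} = {#}" by (simp add: root_part_def)
  ultimately show ?thesis
    unfolding ext_cuts_eq using fin by (subst sum.insert) (simp_all only: mem_Collect_eq not_False_eq_True)
qed

definition below :: "nat list set \<Rightarrow> nat \<Rightarrow> nat list set" where
  "below c i = {p. i # p \<in> c}"

lemma cut_decompose:
  assumes "c \<subseteq> edges (PNode ts)"
  shows "(\<Union>i<length ts. (#) i ` below c i) = c"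
proof
  show "(\<Union>i<length ts. (#) i ` below c i) \<subseteq> c" unfolding below_def by blast
  show "c \<subseteq> (\<Union>i<length ts. (#) i ` below c i)"
  proof
    fix p assume p: "p \<in> c"
    then have "is_vertex (PNode ts) p" "p \<noteq> []" using assms unfolding edges_def by blast+
    then obtain i q where iq: "p = i # q" "i < length ts" by (cases p) simp_all
    have "q \<in> below c i" using p unfolding iq(1) below_def by (rule CollectI)
    then show "p \<in> (\<Union>i<length ts. (#) i ` below c i)" using iq by blast
  qed
qed

lemma pruned_PNode:
  assumes "c \<subseteq> edges (PNode ts)"
  shows "pruned (PNode ts) c = (\<Sum>i<length ts. pruned (ts ! i) (below c i))"
proof -
  have fin: "finite c" using assms by (intro finite_cut[of _ "PNode ts"]) (auto simp: edges_def)
  have finb: "finite (below c i)" for i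
    unfolding below_def using finite_vimageI[OF fin, of "(#) i"] by (simp add: vimage_def)
  have c: "c = (\<Union>i<length ts. (#) i ` below c i)"
    by (rule cut_decompose[OF assms, symmetric])
  have mset_Union: "mset_set (\<Union>i<k. (#) i ` below c i) = (\<Sum>i<k. mset_set ((#) i ` below c i))" for k
  proof (induction k)
    case (Suc k)
    have "(\<Union>i<Suc k. (#) i ` below c i) = (#) k ` below c k \<union> (\<Union>i<k. (#) i ` below c i)"
      by (auto simp: lessThan_Suc)
    then show ?case using Suc finb by (simp, subst mset_set_Union) (auto simp: add.commute)
  qed simp
  have image_sum: "image_mset f (\<Sum>i<k. m i) = (\<Sum>i<k. image_mset f (m i))"
    for f :: "nat list \<Rightarrow> rtree" and m :: "nat \<Rightarrow> nat list multiset" and k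
    by (induction k) simp_all
  let ?g = "\<lambda>c t e. trunk (subtree t e) {p. p \<noteq> [] \<and> e @ p \<in> c}"
  have "pruned (PNode ts) c =
      image_mset (?g c (PNode ts)) (mset_set (\<Union>i<length ts. (#) i ` below c i))"
    unfolding pruned_def by (simp only: flip: c)
  also have "\<dots> = (\<Sum>i<length ts. image_mset (?g c (PNode ts)) (mset_set ((#) i ` below c i)))"
    unfolding mset_Union by (rule image_sum)
  also have "\<dots> = (\<Sum>i<length ts. pruned (ts ! i) (below c i))"
  proof (rule sum.cong)
    fix i
    have "mset_set ((#) i ` below c i) = image_mset ((#) i) (mset_set (below c i))"
      by (rule image_mset_mset_set[symmetric]) auto
    then show "image_mset (?g c (PNode ts)) (mset_set ((#) i ` below c i)) = pruned (ts ! i) (below c i)"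
      by (simp add: pruned_def multiset.map_comp comp_def) (simp add: below_def)
  qed simp
  finally show ?thesis .
qed

lemma trunk_PNode:
  "trunk (PNode ts) c = Node (\<Sum>i<length ts. root_part (ts ! i) (below c i))"
proof -
  have "mset (map f (filter P [0..<n])) = (\<Sum>i<n. if P i then {#f i#} else {#})"
    for f :: "nat \<Rightarrow> rtree" and P n
    by (induction n) (auto simp: lessThan_Suc)
  note this[of "\<lambda>i. trunk (ts ! i) {p. i # p \<in> c}" "\<lambda>i. [i] \<notin> c" "length ts"]
  moreover have "(if [i] \<notin> c then {#trunk (ts ! i) {p. i # p \<in> c}#} else {#}) =
      root_part (ts ! i) (below c i)" for i
    by (auto simp: root_part_def below_def)
  ultimately show ?thesis by simp
qed

lemma bij_below:
  "bij_betw (\<lambda>c. restrict (below c) {..<length ts}) {c. admissible (PNode ts) c}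
     (PiE {..<length ts} (\<lambda>i. ext_cuts (ts ! i)))"
proof (rule bij_betwI[where g = "\<lambda>g. \<Union>i<length ts. (#) i ` g i"])
  show "(\<lambda>c. restrict (below c) {..<length ts}) \<in> {c. admissible (PNode ts) c} \<rightarrow>
      (PiE {..<length ts} (\<lambda>i. ext_cuts (ts ! i)))"
    by (fastforce simp: admissible_iff_antichain ext_cuts_def below_def antichain_def edges_def)
  show "(\<lambda>g. \<Union>i<length ts. (#) i ` g i) \<in>
      (PiE {..<length ts} (\<lambda>i. ext_cuts (ts ! i))) \<rightarrow> {c. admissible (PNode ts) c}"
    by (fastforce simp: admissible_iff_antichain ext_cuts_def antichain_def edges_def PiE_iff)
next
  fix c assume "c \<in> {c. admissible (PNode ts) c}"
  then have c: "c \<subseteq> edges (PNode ts)" by (simp add: admissible_def)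
  show "(\<Union>i<length ts. (#) i ` (restrict (below c) {..<length ts}) i) = c"
    using cut_decompose[OF c] by simp
next
  fix g assume g: "g \<in> PiE {..<length ts} (\<lambda>i. ext_cuts (ts ! i))"
  show "restrict (below (\<Union>i<length ts. (#) i ` g i)) {..<length ts} = g"
  proof
    fix i
    show "restrict (below (\<Union>i<length ts. (#) i ` g i)) {..<length ts} i = g i"
      using g by (cases "i < length ts") (auto simp: below_def PiE_iff extensional_def)
  qed
qed

definition graft :: "alg2 \<Rightarrow> alg2" where
  "graft = lin_ext (\<lambda>(F, G). basis (F, {#Node G#}))"

lemma sum_admissible_PNode:
  "(\<Sum>c | admissible (PNode ts) c. basis (pruned (PNode ts) c, {#trunk (PNode ts) c#})) =
     graft (\<Prod>i<length ts. \<Sum>c\<in>ext_cuts (ts ! i). basis (pruned (ts ! i) c, root_part (ts ! i) c))"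
proof -
  let ?h = "\<lambda>i c. (pruned (ts ! i) c, root_part (ts ! i) c)"
  let ?G = "\<lambda>g. graft (basis (\<Sum>i<length ts. ?h i (g i)))"
  have "graft (\<Prod>i<length ts. \<Sum>c\<in>ext_cuts (ts ! i). basis (?h i c)) =
      (\<Sum>g\<in>PiE {..<length ts} (\<lambda>i. ext_cuts (ts ! i)). ?G g)"
    by (subst prod_sum_PiE) (simp_all add: finite_ext_cuts prod_basis graft_def lin_ext_sum)
  also have "\<dots> = (\<Sum>c | admissible (PNode ts) c. ?G (restrict (below c) {..<length ts}))"
    by (rule sum.reindex_bij_betw[OF bij_below, symmetric])
  also have "\<dots> = (\<Sum>c | admissible (PNode ts) c.
      basis (pruned (PNode ts) c, {#trunk (PNode ts) c#}))"
    by (intro sum.cong)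
       (simp_all add: graft_def case_prod_beta fst_sum snd_sum pruned_PNode trunk_PNode admissible_def
         del: trunk.simps)
  finally show ?thesis ..
qed

primrec coprod_rec :: "rtree \<Rightarrow> alg2" where
  "coprod_rec (Node M) =
     basis ({#Node M#}, {#}) + graft (\<Prod>\<^sub># (image_mset coprod_rec M))"

lemma coprod_rec_shape:
  "coprod_rec (shape t) = (\<Sum>c\<in>ext_cuts t. basis (pruned t c, root_part t c))"
proof (induction t)
  case (PNode ts)
  have "\<Prod>\<^sub># (image_mset coprod_rec (mset (map shape ts))) =
      prod_list (map (\<lambda>t. coprod_rec (shape t)) ts)"
    by (simp flip: mset_map add: prod_mset_prod_list comp_def)
  also have "\<dots> = (\<Prod>i<length ts. coprod_rec (shape (ts ! i)))"
    by (induction ts rule: rev_induct) (simp_all add: lessThan_Suc nth_append mult.commute)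
  finally show ?case
    by (simp add: sum_ext_cuts[of "PNode ts"] sum_admissible_PNode PNode del: trunk.simps)
qed

lemma ex_shape: "\<exists>t. shape t = \<tau>"
proof (induction \<tau>)
  case (Node M)
  then have "\<exists>ts. mset (map shape ts) = M"
  proof (induction M)
    case (add x M)
    then have "\<exists>t. shape t = x" "\<exists>ts. mset (map shape ts) = M" by simp_all
    then obtain t ts where "shape t = x" "mset (map shape ts) = M" by blast
    then show ?case by (intro exI[of _ "t # ts"]) simp
  qed simp
  then show ?case by (metis shape.simps)
qed

lemma shape_planar [simp]: "shape (planar \<tau>) = \<tau>"
  unfolding planar_def by (rule someI_ex) (rule ex_shape)

theorem coprod_tree_shape:
  "coprod_tree (shape t) =
     tensor (basis {#shape t#}) 1 + tensor 1 (basis {#shape t#}) +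
     (\<Sum>c | admissible t c \<and> c \<noteq> {}. tensor (basis (pruned t c)) (basis {#trunk t c#}))"
  and coprod_tree_Node:
  "coprod_tree (Node M) =
     tensor (basis {#Node M#}) 1 + graft (\<Prod>\<^sub># (image_mset coprod_tree M))"
proof -
  have *: "tensor (basis {#shape t#}) 1 + tensor 1 (basis {#shape t#}) +
     (\<Sum>c | admissible t c \<and> c \<noteq> {}. tensor (basis (pruned t c)) (basis {#trunk t c#})) =
     coprod_rec (shape t)" for t
  proof -
    have "{c. admissible t c} \<subseteq> ext_cuts t" by (auto simp: ext_cuts_eq)
    then have fin: "finite {c. admissible t c}" using finite_ext_cuts finite_subset by blast
    have "{c. admissible t c} = insert {} {c. admissible t c \<and> c \<noteq> {}}"
      by (auto simp: admissible_def)
    then show ?thesis unfolding coprod_rec_shape sum_ext_cuts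
      using fin by (simp add: add.assoc) (simp add: pruned_def)
  qed
  have eq: "coprod_tree = coprod_rec"
    using *[of "planar _"] by (auto simp: coprod_tree_def)
  show "coprod_tree (shape t) =
     tensor (basis {#shape t#}) 1 + tensor 1 (basis {#shape t#}) +
     (\<Sum>c | admissible t c \<and> c \<noteq> {}. tensor (basis (pruned t c)) (basis {#trunk t c#}))"
    by (simp only: * eq)
  show "coprod_tree (Node M) =
     tensor (basis {#Node M#}) 1 + graft (\<Prod>\<^sub># (image_mset coprod_tree M))"
    by (simp add: eq)
qed

end

theory Submission
  imports
    Defs
    "HOL-Computational_Algebra.Primes"
    "HOL-Computational_Algebra.Polynomial"
begin

text \<open>
  The unital algebra homomorphisms from \<open>alg\<close> to a commutative algebra (the \<^emph>\<open>characters\<close>) form a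
  group under convolution. Two structural facts make it easy to handle. It is triangular: the
  value of \<open>f \<star> g\<close> on a tree \<open>\<tau>\<close> is \<open>f \<tau> + g \<tau>\<close> plus an expression in the values on smaller
  trees (\<open>conv_diff\<close>), so inverses and square roots exist, are unique, and depend on \<open>f\<close> in the
  same triangular way. And it is graded, so \<open>bar f \<tau> = (-1)\<^bsup>|\<tau>|\<^esup> f \<tau>\<close>, which reverses the sign of
  the step size, is an automorphism.

  Composing a character \<open>\<psi>\<close> with the maps minus and plus gives the characters
  \<open>q = ((bar \<psi>)\<^bsup>-1\<^esup> \<star> \<psi>)\<^bsup>1/2\<^esup>\<close> and \<open>p = \<psi> \<star> q\<^bsup>-1\<^esup>\<close>. By uniqueness of square roots
  \<open>bar q = q\<^bsup>-1\<^esup>\<close>, and then \<open>bar p = p\<close>. Three consequences decide everything: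

    \<^item> \<open>p\<close> vanishes on every tree with an odd number of vertices, whatever \<open>\<psi>\<close> is
      (\<open>plus_part_odd\<close>);

    \<^item> on a tree \<open>\<tau>\<close> with an even number of vertices, \<open>p \<tau>\<close> is \<open>\<psi> \<tau>\<close> plus an expression in the
      values of \<open>\<psi>\<close> on smaller trees (\<open>plus_part_diff\<close>);

    \<^item> \<open>p\<close> is trivial for the exact flow \<open>\<tau> \<mapsto> 1 / \<tau>!\<close>, because running the flow forwards and then
      backwards is the identity (\<open>plus_part_flow\<close>).

  Hence one may prescribe \<open>\<psi>\<close> freely on odd trees and \<open>p\<close> freely on even trees: solving upwards
  in the number of vertices, exactly one \<open>\<psi>\<close> results (\<open>ex_character_with_plus_part\<close>). Prescribe
  \<open>1 / \<tau>!\<close> on the odd trees, except that it is off by \<open>1\<close> at the odd size \<open>n + 1\<close>, and prescribe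
  \<open>p = 0\<close> on the even trees, except that \<open>p = 1\<close> at the even size \<open>m + 1\<close>. Up to size \<open>n\<close> the
  exact flow satisfies the same prescription, so \<open>\<psi>\<close> coincides with it there; thus \<open>\<psi>\<close> has order
  exactly \<open>n\<close> and antisymmetric order exactly \<open>m\<close>.

  It remains to realise finitely many prescribed values by an explicit scheme, which is always
  possible (\<open>ex_explicit_weights\<close>). Weights of explicit schemes are closed under sums (put the
  schemes side by side) and, adding one stage fed by the weights \<open>b\<close> of a scheme, under
  \<open>w \<mapsto> (Node M \<mapsto> c * (\<Prod>\<tau>\<in>#M. w \<tau>))\<close>. If small trees are labelled by distinct primes, then distinct
  forests have distinct products of labels, so polynomial interpolation in these products
  gives arbitrary values on the next size of trees.
\<close>


section \<open>Linear maps on free vector spaces\<close>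

lemma lin_ext_lin_ext:
  "linear h \<Longrightarrow> h (lin_ext f x) = lin_ext (\<lambda>k. h (f k)) x"
  by (simp add: lin_ext_def linear_sum linear_scale)

lemma lin_ext_basis_id: "lin_ext basis x = x"
proof (rule poly_mapping_eqI)
  fix k
  show "Poly_Mapping.lookup (lin_ext basis x) k = Poly_Mapping.lookup x k"
    by (simp add: lin_ext_def lookup_sum scaleR_poly_mapping.rep_eq lookup_single when_def
        in_keys_iff if_distrib[of "\<lambda>z. _ * z"] sum.delta' cong: if_cong)
qed

lemma linear_eq_on_basis:
  assumes "linear f" "linear g" "\<And>k. f (basis k) = g (basis k)"
  shows "f x = g x"
proof -
  have "f (lin_ext basis x) = g (lin_ext basis x)"
    by (simp only: lin_ext_lin_ext[OF assms(1)] lin_ext_lin_ext[OF assms(2)] assms(3))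
  then show ?thesis by (simp only: lin_ext_basis_id)
qed

lemma linear_comp: "linear f \<Longrightarrow> linear g \<Longrightarrow> linear (\<lambda>x. f (g x))"
  using linear_compose[of g f] by (simp add: comp_def)

lemma linear_mult_left_of: "linear h \<Longrightarrow> linear (\<lambda>x. h x * (c::'b::real_algebra_1))"
  by (rule linearI) (simp_all add: linear_add linear_scale distrib_right)

lemma linear_mult_right_of: "linear h \<Longrightarrow> linear (\<lambda>x. (c::'b::real_algebra_1) * h x)"
  by (rule linearI) (simp_all add: linear_add linear_scale distrib_left)

lemma lin_ext_add: "lin_ext f (x + y) = lin_ext f x + lin_ext f y"
  by (rule linear_add[OF linear_lin_ext])

lemma lin_ext_fun_add: "lin_ext (\<lambda>k. f k + g k) x = lin_ext f x + lin_ext g x"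
  by (simp add: lin_ext_def scaleR_add_right sum.distrib)

lemma unital_alg_hom_lin_ext:
  fixes h :: "'a::comm_monoid_add \<Rightarrow> 'b::{real_algebra_1,comm_ring_1}"
  assumes "h 0 = 1" "\<And>a b. h (a + b) = h a * h b"
  shows "unital_alg_hom (lin_ext h)"
  unfolding unital_alg_hom_def
proof (intro conjI allI)
  show "linear (lin_ext h)" by (rule linear_lin_ext)
  show "lin_ext h 1 = 1" using lin_ext_basis[of h 0] by (simp add: assms(1))
  fix x y :: "'a \<Rightarrow>\<^sub>0 real"
  have *: "lin_ext h (basis k * y) = h k * lin_ext h y" for k
  proof (rule linear_eq_on_basis[where x = y])
    show "linear (\<lambda>y. lin_ext h (basis k * y))"
      by (intro linear_comp[OF linear_lin_ext] linear_mult_right_of linear_ident)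
    show "linear (\<lambda>y. h k * lin_ext h y)"
      by (intro linear_mult_right_of linear_lin_ext)
  qed (simp add: mult_single assms(2))
  show "lin_ext h (x * y) = lin_ext h x * lin_ext h y"
  proof (rule linear_eq_on_basis[where x = x])
    show "linear (\<lambda>x. lin_ext h (x * y))"
      by (intro linear_comp[OF linear_lin_ext] linear_mult_left_of linear_ident)
    show "linear (\<lambda>x. lin_ext h x * lin_ext h y)"
      by (intro linear_mult_left_of linear_lin_ext)
  qed (simp add: *)
qed


section \<open>Algebra homomorphisms\<close>

abbreviation tree :: "rtree \<Rightarrow> alg" where
  "tree \<tau> \<equiv> basis {#\<tau>#}"

lemma alg_hom_linear: "unital_alg_hom f \<Longrightarrow> linear f"
  and alg_hom_one: "unital_alg_hom f \<Longrightarrow> f 1 = 1"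
  and alg_hom_mult: "unital_alg_hom f \<Longrightarrow> f (x * y) = f x * f y"
  by (simp_all add: unital_alg_hom_def)

lemma alg_hom_comp:
  "unital_alg_hom f \<Longrightarrow> unital_alg_hom g \<Longrightarrow> unital_alg_hom (\<lambda>x. f (g x))"
  by (simp add: unital_alg_hom_def linear_comp)

lemma alg_hom_id: "unital_alg_hom (\<lambda>x. x)"
  by (simp add: unital_alg_hom_def linear_ident)

lemma alg_hom_alg_ext: "unital_alg_hom (alg_ext g)"
  unfolding alg_ext_def by (rule unital_alg_hom_lin_ext) simp_all

lemma alg_ext_tree [simp]: "alg_ext g (tree \<tau>) = g \<tau>"
  by (simp add: alg_ext_def)

lemma alg_ext_basis: "alg_ext g (basis F) = \<Prod>\<^sub># (image_mset g F)"
  by (simp add: alg_ext_def)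

lemma basis_empty: "basis {#} = (1::alg)"
  by (simp flip: zero_multiset_def)

lemma basis_plus: "basis (F + G) = basis F * (basis G :: 'a::monoid_add \<Rightarrow>\<^sub>0 real)"
  by (simp add: mult_single)

lemma alg_hom_basis:
  fixes f :: "alg \<Rightarrow> 'b::{real_algebra_1,comm_ring_1}"
  assumes "unital_alg_hom f"
  shows "f (basis F) = \<Prod>\<^sub># (image_mset (\<lambda>\<tau>. f (tree \<tau>)) F)"
proof (induction F)
  case empty
  then show ?case using assms by (simp add: basis_empty alg_hom_one)
next
  case (add \<tau> F)
  have "basis (add_mset \<tau> F) = tree \<tau> * basis F" by (simp add: mult_single)
  then show ?case using add assms by (simp add: alg_hom_mult)
qed

lemma alg_hom_eq_on_basis:
  fixes f g :: "alg \<Rightarrow> 'b::{real_algebra_1,comm_ring_1}"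
  assumes "unital_alg_hom f" "unital_alg_hom g" "\<And>\<tau>. \<tau> \<in># F \<Longrightarrow> f (tree \<tau>) = g (tree \<tau>)"
  shows "f (basis F) = g (basis F)"
proof -
  have "image_mset (\<lambda>\<tau>. f (tree \<tau>)) F = image_mset (\<lambda>\<tau>. g (tree \<tau>)) F"
    by (intro image_mset_cong assms(3))
  then show ?thesis
    using alg_hom_basis[OF assms(1), of F] alg_hom_basis[OF assms(2), of F] by argo
qed

lemma alg_hom_eqI:
  fixes f g :: "alg \<Rightarrow> 'b::{real_algebra_1,comm_ring_1}"
  assumes "unital_alg_hom f" "unital_alg_hom g" "\<And>\<tau>. f (tree \<tau>) = g (tree \<tau>)"
  shows "f = g"
proof
  fix x show "f x = g x"
    by (rule linear_eq_on_basis[OF alg_hom_linear[OF assms(1)] alg_hom_linear[OF assms(2)]],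
        rule alg_hom_eq_on_basis[OF assms])
qed


section \<open>Convolution\<close>

text \<open>
  Unlike \<open>convolution\<close>, the target may be any commutative algebra: \<open>\<real>\<close> for characters, \<open>alg\<close> for
  the maps that define plus and minus, and the triple tensor product below.
\<close>

definition conv :: "(alg \<Rightarrow> 'b) \<Rightarrow> (alg \<Rightarrow> 'b) \<Rightarrow> alg \<Rightarrow> 'b::{real_algebra_1,comm_ring_1}"
    (infixl "\<star>" 75) where
  "(f \<star> g) x = lin_ext (\<lambda>(F, G). f (basis F) * g (basis G)) (coprod x)"

lemma mu_tensor: "mu (tensor x y) = x * y"
proof (rule linear_eq_on_basis[where x = x])
  show "linear (\<lambda>x. mu (tensor x y))"
    unfolding mu_def tensor_def by (rule linear_comp[OF linear_lin_ext linear_lin_ext])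
  show "linear (\<lambda>x. x * y)" by (rule linear_mult_left_of[OF linear_ident])
  fix F
  show "mu (tensor (basis F) y) = basis F * y"
  proof (rule linear_eq_on_basis[where x = y])
    show "linear (\<lambda>y. mu (tensor (basis F) y))"
      unfolding mu_def tensor_def lin_ext_basis by (rule linear_comp[OF linear_lin_ext linear_lin_ext])
    show "linear (\<lambda>y. basis F * y)" by (rule linear_mult_right_of[OF linear_ident])
  qed (simp add: mu_def)
qed

lemma convolution_eq: "convolution f g = f \<star> g"
proof
  fix x
  have "linear mu" by (simp add: mu_def linear_lin_ext)
  then show "convolution f g x = (f \<star> g) x"
    by (simp add: convolution_def conv_def tensor_map_def lin_ext_lin_ext mu_tensor case_prod_unfold)
qed

lemma linear_conv: "linear (f \<star> g)"
  unfolding conv_def[abs_def] coprod_def alg_ext_def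
  by (rule linear_comp[OF linear_lin_ext linear_lin_ext])

lemma alg_hom_conv:
  assumes "unital_alg_hom f" "unital_alg_hom g"
  shows "unital_alg_hom (f \<star> g)"
  unfolding conv_def[abs_def] coprod_def
proof (intro alg_hom_comp[OF _ alg_hom_alg_ext] unital_alg_hom_lin_ext)
  fix a b :: "forest \<times> forest"
  show "(case a + b of (F, G) \<Rightarrow> f (basis F) * g (basis G)) =
      (case a of (F, G) \<Rightarrow> f (basis F) * g (basis G)) * (case b of (F, G) \<Rightarrow> f (basis F) * g (basis G))"
    by (simp add: case_prod_unfold basis_plus alg_hom_mult[OF assms(1)] alg_hom_mult[OF assms(2)] mult_ac)
qed (use assms in \<open>simp add: zero_prod_def alg_hom_one\<close>)

lemma comp_conv:
  assumes "unital_alg_hom h"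
  shows "h ((f \<star> g) x) = ((\<lambda>y. h (f y)) \<star> (\<lambda>y. h (g y))) x"
  using assms by (simp add: conv_def lin_ext_lin_ext alg_hom_linear case_prod_unfold alg_hom_mult)

definition add_root :: "alg \<Rightarrow> alg" where
  "add_root = lin_ext (\<lambda>F. tree (Node F))"

lemma add_root_basis [simp]: "add_root (basis F) = tree (Node F)"
  by (simp add: add_root_def)

lemma coprod_tree_eq [simp]: "coprod (tree \<tau>) = coprod_tree \<tau>"
  by (simp add: coprod_def)

lemma coprod_basis: "coprod (basis F) = \<Prod>\<^sub># (image_mset coprod_tree F)"
  by (simp add: coprod_def alg_ext_basis)

text \<open>
  The cocycle property of grafting, \<open>\<Delta>(B\<^sub>+ M) = B\<^sub>+ M \<otimes> 1 + (id \<otimes> B\<^sub>+) \<Delta>(M)\<close>, in dual form. It is the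
  tool for all inductions over trees; note that \<open>g \<circ> B\<^sub>+\<close> is no longer multiplicative.
\<close>

lemma conv_Node:
  assumes "g 1 = 1"
  shows "(f \<star> g) (tree (Node M)) = f (tree (Node M)) + (f \<star> (\<lambda>x. g (add_root x))) (basis M)"
proof -
  have "lin_ext (\<lambda>(F, G). f (basis F) * g (basis G)) (graft z) =
      lin_ext (\<lambda>(F, G). f (basis F) * g (add_root (basis G))) z" for z
    unfolding graft_def by (subst lin_ext_lin_ext[OF linear_lin_ext]) (simp add: case_prod_unfold)
  then show ?thesis
    using assms by (simp add: conv_def coprod_tree_Node coprod_basis lin_ext_add basis_empty)
qed

lemma conv_add_right: "(f \<star> (\<lambda>x. g x + h x)) x = (f \<star> g) x + (f \<star> h) x"
  unfolding conv_def lin_ext_fun_add[symmetric]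
  by (simp add: case_prod_unfold algebra_simps)


section \<open>Coassociativity\<close>

text \<open>
  The two iterated coproducts are the algebra homomorphisms \<open>(leg1 \<star> leg2) \<star> leg3\<close> and
  \<open>leg1 \<star> (leg2 \<star> leg3)\<close> into the triple tensor product, where \<open>leg1\<close>, \<open>leg2\<close>, \<open>leg3\<close> are the three
  embeddings of \<open>alg\<close>. Every triple convolution factors through one of them by way of \<open>triple\<close>, so
  associativity for arbitrary functions follows once these two homomorphisms agree on trees.
\<close>

type_synonym alg3 = "(forest \<times> forest \<times> forest) \<Rightarrow>\<^sub>0 real"

definition leg1 :: "alg \<Rightarrow> alg3" where "leg1 = lin_ext (\<lambda>F. basis (F, {#}, {#}))"
definition leg2 :: "alg \<Rightarrow> alg3" where "leg2 = lin_ext (\<lambda>F. basis ({#}, F, {#}))"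
definition leg3 :: "alg \<Rightarrow> alg3" where "leg3 = lin_ext (\<lambda>F. basis ({#}, {#}, F))"

lemma leg_basis [simp]:
  "leg1 (basis F) = basis (F, {#}, {#})"
  "leg2 (basis F) = basis ({#}, F, {#})"
  "leg3 (basis F) = basis ({#}, {#}, F)"
  by (simp_all add: leg1_def leg2_def leg3_def)

lemma alg_hom_leg: "unital_alg_hom leg1" "unital_alg_hom leg2" "unital_alg_hom leg3"
proof -
  have one: "basis ({#}, {#}, {#}) = (1 :: alg3)"
    by (simp flip: zero_multiset_def zero_prod_def)
  show "unital_alg_hom leg1" "unital_alg_hom leg2" "unital_alg_hom leg3"
    unfolding leg1_def leg2_def leg3_def
    by (rule unital_alg_hom_lin_ext; simp add: one mult_single)+
qed

definition triple ::
    "(alg \<Rightarrow> 'b) \<Rightarrow> (alg \<Rightarrow> 'b) \<Rightarrow> (alg \<Rightarrow> 'b) \<Rightarrow> alg3 \<Rightarrow> 'b::{real_algebra_1,comm_ring_1}"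
  where "triple f g h =
    lin_ext (\<lambda>(F, G, H). f (basis F) * g (basis G) * h (basis H))"

lemma linear_triple: "linear (triple f g h)"
  by (simp add: triple_def linear_lin_ext)

lemma conv_conv_left: "((f \<star> g) \<star> h) x = triple f g h (((leg1 \<star> leg2) \<star> leg3) x)"
proof -
  have *: "triple f g h (lin_ext (\<lambda>(F, G). leg1 (basis F) * leg2 (basis G)) z * leg3 (basis H)) =
      lin_ext (\<lambda>(F, G). f (basis F) * g (basis G)) z * h (basis H)" for z H
    by (rule linear_eq_on_basis[where x = z],
        rule linear_comp[OF linear_triple linear_mult_left_of[OF linear_lin_ext]],
        rule linear_mult_left_of[OF linear_lin_ext])
       (simp add: mult_single case_prod_unfold triple_def)
  have "((f \<star> g) \<star> h) x =
      lin_ext (\<lambda>(A, H). triple f g h ((leg1 \<star> leg2) (basis A) * leg3 (basis H))) (coprod x)"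
    by (simp only: conv_def[of _ h] conv_def[of f g] conv_def[of leg1 leg2] *)
  also have "\<dots> = triple f g h (((leg1 \<star> leg2) \<star> leg3) x)"
    by (simp only: conv_def[of _ leg3] lin_ext_lin_ext[OF linear_triple] case_prod_unfold)
  finally show ?thesis .
qed

lemma conv_conv_right: "(f \<star> (g \<star> h)) x = triple f g h ((leg1 \<star> (leg2 \<star> leg3)) x)"
proof -
  have *: "triple f g h (leg1 (basis F) * lin_ext (\<lambda>(G, H). leg2 (basis G) * leg3 (basis H)) z) =
      f (basis F) * lin_ext (\<lambda>(G, H). g (basis G) * h (basis H)) z" for z F
    by (rule linear_eq_on_basis[where x = z],
        rule linear_comp[OF linear_triple linear_mult_right_of[OF linear_lin_ext]],
        rule linear_mult_right_of[OF linear_lin_ext])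
       (simp add: mult_single case_prod_unfold triple_def mult.assoc)
  have "(f \<star> (g \<star> h)) x =
      lin_ext (\<lambda>(F, B). triple f g h (leg1 (basis F) * (leg2 \<star> leg3) (basis B))) (coprod x)"
    by (simp only: conv_def[of f "g \<star> h"] conv_def[of g h] conv_def[of leg2 leg3] *)
  also have "\<dots> = triple f g h ((leg1 \<star> (leg2 \<star> leg3)) x)"
    by (simp only: conv_def[of leg1 "_ \<star> _"] lin_ext_lin_ext[OF linear_triple] case_prod_unfold)
  finally show ?thesis .
qed

text \<open>
  By the cocycle property, the values on \<open>Node M\<close> reduce to values on the forest \<open>M\<close> of triple
  convolutions with last factor \<open>leg3 \<circ> B\<^sub>+\<close>. These factor through the iterated coproducts of \<open>M\<close>,
  which agree by the induction hypothesis and multiplicativity.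
\<close>

lemma iterated_coprod_eq: "(leg1 \<star> leg2) \<star> leg3 = leg1 \<star> (leg2 \<star> leg3)"
proof -
  let ?L = "(leg1 \<star> leg2) \<star> leg3" and ?R = "leg1 \<star> (leg2 \<star> leg3)"
  have hom: "unital_alg_hom ?L" "unital_alg_hom ?R"
    by (intro alg_hom_conv alg_hom_leg)+
  have one: "leg2 1 = 1" "leg3 1 = 1" "(leg2 \<star> leg3) 1 = 1"
    by (intro alg_hom_one alg_hom_conv alg_hom_leg)+
  have "?L (tree \<tau>) = ?R (tree \<tau>)" for \<tau>
  proof (induction \<tau>)
    case (Node M)
    let ?B2 = "\<lambda>x. leg2 (add_root x)" and ?B3 = "\<lambda>x. leg3 (add_root x)"
    have IH: "?L (basis M) = ?R (basis M)"
      by (rule alg_hom_eq_on_basis[OF hom Node.IH])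
    have "?L (tree (Node M)) = leg1 (tree (Node M)) + (leg1 \<star> ?B2) (basis M)
        + ((leg1 \<star> leg2) \<star> ?B3) (basis M)"
      by (simp only: conv_Node[of leg3 "leg1 \<star> leg2", OF one(2)] conv_Node[of leg2 leg1, OF one(1)])
    also have "((leg1 \<star> leg2) \<star> ?B3) (basis M) = (leg1 \<star> (leg2 \<star> ?B3)) (basis M)"
      by (simp only: conv_conv_left[of leg1 leg2 ?B3] conv_conv_right[of leg1 leg2 ?B3] IH)
    also have "leg1 (tree (Node M)) + (leg1 \<star> ?B2) (basis M) + \<dots> =
        leg1 (tree (Node M)) + (leg1 \<star> (\<lambda>x. ?B2 x + (leg2 \<star> ?B3) x)) (basis M)"
      by (simp only: conv_add_right add.assoc)
    also have "(leg1 \<star> (\<lambda>x. ?B2 x + (leg2 \<star> ?B3) x)) (basis M) =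
        (leg1 \<star> (\<lambda>x. (leg2 \<star> leg3) (add_root x))) (basis M)"
      by (simp only: conv_def[of leg1] add_root_basis conv_Node[of leg3 leg2, OF one(2)])
    also have "leg1 (tree (Node M)) + \<dots> = ?R (tree (Node M))"
      by (simp only: conv_Node[of "leg2 \<star> leg3" leg1, OF one(3)])
    finally show ?case .
  qed
  then show ?thesis using hom by (intro alg_hom_eqI)
qed

theorem conv_assoc: "(f \<star> g) \<star> h = f \<star> (g \<star> h)"
  by (rule ext) (simp only: conv_conv_left[of f g h] conv_conv_right[of f g h] iterated_coprod_eq)


section \<open>The grading\<close>

lemma vertices_pos [simp]: "vertices \<tau> > 0"
  by (cases \<tau>) simp

lemma vertices_neq_0 [simp]: "vertices \<tau> \<noteq> 0"
  using vertices_pos[of \<tau>] by linarith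

lemma forest_vertices_simps [simp]:
  "forest_vertices {#} = 0"
  "forest_vertices (add_mset \<tau> F) = vertices \<tau> + forest_vertices F"
  "forest_vertices (F + G) = forest_vertices F + forest_vertices G"
  by (simp_all add: forest_vertices_def)

lemma vertices_Node [simp]: "vertices (Node M) = Suc (forest_vertices M)"
  by (simp add: forest_vertices_def)

declare vertices.simps [simp del]

lemma vertices_le_forest_vertices: "\<tau> \<in># F \<Longrightarrow> vertices \<tau> \<le> forest_vertices F"
  by (auto dest!: multi_member_split)

lemma forest_vertices_pos_iff: "forest_vertices F > 0 \<longleftrightarrow> F \<noteq> {#}"
  by (cases F) auto

lemma forest_vertices_sum: "forest_vertices (\<Sum>i\<in>I. F i) = (\<Sum>i\<in>I. forest_vertices (F i))"
  by (induction I rule: infinite_finite_induct) simp_all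

lemma forest_vertices_mset: "forest_vertices (mset \<tau>s) = (\<Sum>i<length \<tau>s. vertices (\<tau>s ! i))"
  by (induction \<tau>s rule: rev_induct) (simp_all add: nth_append lessThan_Suc)

text \<open>
  A cut distributes the vertices among the components. Extended cuts are used because their
  restrictions to the subtrees at the root are again extended cuts.
\<close>

lemma vertices_cut:
  "c \<in> ext_cuts t \<Longrightarrow>
    forest_vertices (pruned t c) + forest_vertices (root_part t c) = vertices (shape t)"
proof (induction t arbitrary: c)
  case (PNode ts)
  show ?case
  proof (cases "c = {[]}")
    case True
    have "{p. p \<noteq> [] \<and> [] @ p \<in> {[]}} = ({} :: nat list set)" by blast
    moreover have "mset_set {[] :: nat list} = {#[]#}" by simp
    ultimately have "pruned (PNode ts) {[]} = {#shape (PNode ts)#}"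
      by (simp only: pruned_def image_mset_single subtree.simps trunk_empty)
    then show ?thesis using True by (simp add: root_part_def)
  next
    case False
    then have adm: "admissible (PNode ts) c" using PNode.prems by (auto simp: ext_cuts_eq)
    then have sub: "c \<subseteq> edges (PNode ts)" by (simp add: admissible_def)
    then have root: "root_part (PNode ts) c = {#trunk (PNode ts) c#}"
      by (auto simp: root_part_def edges_def)
    have "below c i \<in> ext_cuts (ts ! i)" if "i < length ts" for i
      using bij_betw_apply[OF bij_below, of c ts] adm that by (auto simp: PiE_iff)
    then have IH: "forest_vertices (pruned (ts ! i) (below c i)) +
        forest_vertices (root_part (ts ! i) (below c i)) = vertices (shape (ts ! i))"
      if "i < length ts" for i
      using PNode.IH that by simp
    have "forest_vertices (pruned (PNode ts) c) + forest_vertices (root_part (PNode ts) c) =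
        Suc (\<Sum>i<length ts. vertices (shape (ts ! i)))"
      unfolding root pruned_PNode[OF sub] trunk_PNode
      by (simp add: forest_vertices_sum IH flip: sum.distrib)
    then show ?thesis by (simp add: forest_vertices_mset del: mset_map)
  qed
qed

text \<open>
  All that later arguments use about cuts: apart from the two primitive terms, the coproduct
  of a tree is a sum of products of strictly smaller pieces of the right total size.
\<close>

lemma coprod_tree_graded:
  obtains C :: "nat list set set" and P R :: "nat list set \<Rightarrow> forest" where
    "coprod_tree \<tau> = basis ({#\<tau>#}, {#}) + basis ({#}, {#\<tau>#}) + (\<Sum>c\<in>C. basis (P c, R c))"
    "\<And>c. c \<in> C \<Longrightarrow> forest_vertices (P c) + forest_vertices (R c) = vertices \<tau>"
    "\<And>c. c \<in> C \<Longrightarrow> forest_vertices (P c) < vertices \<tau>"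
    "\<And>c. c \<in> C \<Longrightarrow> forest_vertices (R c) < vertices \<tau>"
proof -
  define t where "t = planar \<tau>"
  let ?C = "{c. admissible t c \<and> c \<noteq> {}}"
  have eq: "forest_vertices (pruned t c) + forest_vertices {#trunk t c#} = vertices \<tau>"
    if "c \<in> ?C" for c
  proof -
    have "c \<in> ext_cuts t" "[] \<notin> c"
      using that by (auto simp: ext_cuts_eq admissible_def edges_def)
    then show ?thesis using vertices_cut[of c t] by (simp add: root_part_def t_def)
  qed
  have "pruned t c \<noteq> {#}" if "c \<in> ?C" for c
  proof -
    have "finite c"
      using that by (intro finite_cut[of _ t]) (auto simp: admissible_def edges_def)
    then show ?thesis using that by (auto simp: pruned_def mset_set_empty_iff)
  qed
  then have pos: "forest_vertices (pruned t c) > 0" if "c \<in> ?C" for c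
    using that by (simp only: forest_vertices_pos_iff not_False_eq_True)
  have "coprod_tree \<tau> = basis ({#\<tau>#}, {#}) + basis ({#}, {#\<tau>#}) +
      (\<Sum>c\<in>?C. basis (pruned t c, {#trunk t c#}))"
    unfolding coprod_tree_def t_def by simp
  then show ?thesis
  proof (rule that[where C = ?C and P = "pruned t" and R = "\<lambda>c. {#trunk t c#}"])
    fix c assume c: "c \<in> ?C"
    show "forest_vertices (pruned t c) + forest_vertices {#trunk t c#} = vertices \<tau>"
      by (rule eq[OF c])
    have "forest_vertices {#trunk t c#} > 0" by simp
    then show "forest_vertices (pruned t c) < vertices \<tau>" "forest_vertices {#trunk t c#} < vertices \<tau>"
      using eq[OF c] pos[OF c] by linarith+
  qed
qed


section \<open>The group of characters\<close>

definition agree_below :: "nat \<Rightarrow> (alg \<Rightarrow> 'b) \<Rightarrow> (alg \<Rightarrow> 'b) \<Rightarrow> bool" where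
  "agree_below k f g \<longleftrightarrow> (\<forall>\<tau>. vertices \<tau> < k \<longrightarrow> f (tree \<tau>) = g (tree \<tau>))"

lemma agree_below_basis:
  fixes f g :: "alg \<Rightarrow> 'b::{real_algebra_1,comm_ring_1}"
  assumes "unital_alg_hom f" "unital_alg_hom g" "agree_below k f g" "forest_vertices F < k"
  shows "f (basis F) = g (basis F)"
proof (rule alg_hom_eq_on_basis[OF assms(1,2)])
  fix \<tau> assume "\<tau> \<in># F"
  then have "vertices \<tau> < k" using vertices_le_forest_vertices assms(4) by fastforce
  then show "f (tree \<tau>) = g (tree \<tau>)" using assms(3) by (simp add: agree_below_def)
qed

text \<open>
  Triangularity of convolution: in the terms from proper cuts, only values on smaller trees
  occur, so these cancel.
\<close>

lemma conv_diff:
  fixes f f' g g' :: "alg \<Rightarrow> 'b::{real_algebra_1,comm_ring_1}"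
  assumes hom: "unital_alg_hom f" "unital_alg_hom f'" "unital_alg_hom g" "unital_alg_hom g'"
    and agree: "agree_below (vertices \<tau>) f f'" "agree_below (vertices \<tau>) g g'"
  shows "(f \<star> g) (tree \<tau>) - (f' \<star> g') (tree \<tau>) =
    (f (tree \<tau>) - f' (tree \<tau>)) + (g (tree \<tau>) - g' (tree \<tau>))"
proof -
  obtain C :: "nat list set set" and P R where cop:
    "coprod_tree \<tau> = basis ({#\<tau>#}, {#}) + basis ({#}, {#\<tau>#}) + (\<Sum>c\<in>C. basis (P c, R c))"
    and "\<And>c. c \<in> C \<Longrightarrow> forest_vertices (P c) + forest_vertices (R c) = vertices \<tau>"
    and small: "\<And>c. c \<in> C \<Longrightarrow> forest_vertices (P c) < vertices \<tau>"
      "\<And>c. c \<in> C \<Longrightarrow> forest_vertices (R c) < vertices \<tau>"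
    by (rule coprod_tree_graded[of \<tau>]) (rule that, assumption+)
  have formula: "(u \<star> v) (tree \<tau>) = u (tree \<tau>) + v (tree \<tau>) + (\<Sum>c\<in>C. u (basis (P c)) * v (basis (R c)))"
    if "u 1 = 1" "v 1 = 1" for u v :: "alg \<Rightarrow> 'b"
    using that by (simp add: conv_def cop lin_ext_add lin_ext_sum basis_empty)
  have "(\<Sum>c\<in>C. f (basis (P c)) * g (basis (R c))) = (\<Sum>c\<in>C. f' (basis (P c)) * g' (basis (R c)))"
  proof (rule sum.cong)
    fix c assume c: "c \<in> C"
    show "f (basis (P c)) * g (basis (R c)) = f' (basis (P c)) * g' (basis (R c))"
      by (simp only: agree_below_basis[OF hom(1,2) agree(1) small(1)[OF c]]
          agree_below_basis[OF hom(3,4) agree(2) small(2)[OF c]])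
  qed simp
  then show ?thesis
    using hom by (simp add: formula alg_hom_one)
qed

lemma agree_below_conv:
  fixes f f' g g' :: "alg \<Rightarrow> 'b::{real_algebra_1,comm_ring_1}"
  assumes hom: "unital_alg_hom f" "unital_alg_hom f'" "unital_alg_hom g" "unital_alg_hom g'"
    and agree: "agree_below k f f'" "agree_below k g g'"
  shows "agree_below k (f \<star> g) (f' \<star> g')"
  unfolding agree_below_def
proof (intro allI impI)
  fix \<tau> assume "vertices \<tau> < k"
  then have "agree_below (vertices \<tau>) f f'" "agree_below (vertices \<tau>) g g'"
    "f (tree \<tau>) = f' (tree \<tau>)" "g (tree \<tau>) = g' (tree \<tau>)"
    using agree by (auto simp: agree_below_def)
  with conv_diff[OF hom this(1,2)] show "(f \<star> g) (tree \<tau>) = (f' \<star> g') (tree \<tau>)" by simp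
qed

lemma agree_below_alg_ext:
  "(\<And>\<sigma>. vertices \<sigma> < k \<Longrightarrow> g \<sigma> = g' \<sigma>) \<Longrightarrow> agree_below k (alg_ext g) (alg_ext g')"
  by (simp add: agree_below_def)

text \<open>
  A system whose equation at \<open>\<tau>\<close> is \<open>c\<close> times the unknown at \<open>\<tau>\<close> plus terms in unknowns at
  smaller trees is solved by recursion on the number of vertices. This one lemma provides the
  antipode, the square root of the identity, and the target character.
\<close>

lemma triangular_solve:
  fixes \<Phi> :: "(rtree \<Rightarrow> 'b::real_vector) \<Rightarrow> rtree \<Rightarrow> 'b"
  assumes c: "c \<noteq> 0"
    and tri: "\<And>g g' \<tau>. (\<And>\<sigma>. vertices \<sigma> < vertices \<tau> \<Longrightarrow> g \<sigma> = g' \<sigma>) \<Longrightarrow>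
      \<Phi> g \<tau> - \<Phi> g' \<tau> = c *\<^sub>R (g \<tau> - g' \<tau>)"
  shows "\<exists>g. \<forall>\<tau>. \<Phi> g \<tau> = t \<tau>"
proof -
  \<comment> \<open>The terms in smaller unknowns are \<open>\<Phi>\<close> at \<open>g\<close> cut off at \<open>\<tau>\<close>.\<close>
  let ?low = "\<lambda>g \<tau> \<sigma>. if vertices \<sigma> < vertices \<tau> then g \<sigma> else 0"
  define g where "g = wfrec (Wellfounded.measure vertices)
    (\<lambda>g \<tau>. (1 / c) *\<^sub>R (t \<tau> - \<Phi> (?low g \<tau>) \<tau>))"
  have g: "g \<tau> = (1 / c) *\<^sub>R (t \<tau> - \<Phi> (?low g \<tau>) \<tau>)" for \<tau>
  proof -
    have "?low (cut g (Wellfounded.measure vertices) \<tau>) \<tau> = ?low g \<tau>"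
      by (auto simp: cut_def)
    then show ?thesis
      unfolding g_def by (subst wfrec[OF wf_measure]) simp
  qed
  have "\<Phi> g \<tau> = t \<tau>" for \<tau>
  proof -
    have "\<Phi> g \<tau> - \<Phi> (?low g \<tau>) \<tau> = c *\<^sub>R (g \<tau> - ?low g \<tau> \<tau>)"
      by (rule tri) simp
    also have "\<dots> = t \<tau> - \<Phi> (?low g \<tau>) \<tau>"
      using c by (subst g) simp
    finally show ?thesis by simp
  qed
  then show ?thesis by blast
qed

definition eps :: "alg \<Rightarrow> 'b::{real_algebra_1,comm_ring_1}" where
  "eps = alg_ext (\<lambda>_. 0)"

lemma alg_hom_eps: "unital_alg_hom eps"
  by (simp add: eps_def alg_hom_alg_ext)

lemma eps_tree [simp]: "eps (tree \<tau>) = 0"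
  by (simp add: eps_def)

lemma eps_basis: "eps (basis F) = (if F = {#} then 1 else 0)"
  by (cases F) (simp_all add: eps_def alg_ext_basis alg_hom_one[OF alg_hom_alg_ext])

lemma alg_hom_comp_eps: "unital_alg_hom f \<Longrightarrow> f (eps x) = eps x"
proof -
  assume f: "unital_alg_hom f"
  have "(\<lambda>x. f (eps x)) = eps"
    by (rule alg_hom_eqI[OF alg_hom_comp[OF f alg_hom_eps] alg_hom_eps])
       (simp add: linear_0[OF alg_hom_linear[OF f]])
  then show ?thesis by metis
qed

text \<open>
  The counit composed with the unit map, as it occurs in the definition of the antipode.
\<close>

lemma counit_eq_eps: "(\<lambda>x. counit x *\<^sub>R 1) = (eps :: alg \<Rightarrow> alg)"
proof -
  have "unital_alg_hom (\<lambda>x::real. x *\<^sub>R (1::alg))"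
    unfolding unital_alg_hom_def
    by (auto intro!: linearI simp: scaleR_add_left)
  moreover have "counit = eps" by (simp add: counit_def eps_def)
  ultimately have "counit x *\<^sub>R 1 = (eps x :: alg)" for x
    using alg_hom_comp_eps[of "\<lambda>x::real. x *\<^sub>R (1::alg)" x] by simp
  then show ?thesis by blast
qed

lemma conv_eps_tree:
  fixes f :: "alg \<Rightarrow> 'b::{real_algebra_1,comm_ring_1}"
  assumes "f 1 = 1"
  shows "(eps \<star> f) (tree \<tau>) = f (tree \<tau>)" "(f \<star> eps) (tree \<tau>) = f (tree \<tau>)"
proof -
  obtain C :: "nat list set set" and P R where cop:
    "coprod_tree \<tau> = basis ({#\<tau>#}, {#}) + basis ({#}, {#\<tau>#}) + (\<Sum>c\<in>C. basis (P c, R c))"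
    and size: "\<And>c. c \<in> C \<Longrightarrow> forest_vertices (P c) + forest_vertices (R c) = vertices \<tau>"
    and small: "\<And>c. c \<in> C \<Longrightarrow> forest_vertices (P c) < vertices \<tau>"
      "\<And>c. c \<in> C \<Longrightarrow> forest_vertices (R c) < vertices \<tau>"
    by (rule coprod_tree_graded[of \<tau>]) (rule that, assumption+)
  have "P c \<noteq> {#}" "R c \<noteq> {#}" if "c \<in> C" for c
    using size[OF that] small[OF that] by auto
  then show "(eps \<star> f) (tree \<tau>) = f (tree \<tau>)" "(f \<star> eps) (tree \<tau>) = f (tree \<tau>)"
    using assms by (simp_all add: conv_def cop lin_ext_add lin_ext_sum basis_empty eps_basis)
qed

text \<open>
  On trees this says that proper cuts leave both pieces non-empty. A general linear \<open>f\<close> reduces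
  to the identity map, which is an algebra homomorphism.
\<close>

lemma eps_conv:
  fixes f :: "alg \<Rightarrow> 'b::{real_algebra_1,comm_ring_1}"
  assumes f: "linear f"
  shows "eps \<star> f = f" "f \<star> eps = f"
proof -
  have "eps \<star> (\<lambda>x. x) = (\<lambda>x::alg. x)" "(\<lambda>x. x) \<star> eps = (\<lambda>x::alg. x)"
    by (intro alg_hom_eqI alg_hom_conv alg_hom_eps alg_hom_id; simp add: conv_eps_tree)+
  then have counital: "(eps \<star> (\<lambda>x. x)) x = x" "((\<lambda>x. x) \<star> eps) x = x" for x :: alg
    by metis+
  have "f (eps (basis F) * basis G) = eps (basis F) * f (basis G)"
    "f (basis F * eps (basis G)) = f (basis F) * eps (basis G)" for F G
    using f by (simp_all add: eps_basis linear_0)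
  then have "f ((eps \<star> (\<lambda>x. x)) x) = (eps \<star> f) x" "f (((\<lambda>x. x) \<star> eps) x) = (f \<star> eps) x" for x
    by (simp_all add: conv_def lin_ext_lin_ext[OF f] case_prod_unfold)
  then show "eps \<star> f = f" "f \<star> eps = f" using counital by auto
qed

text \<open>
  Left inverses of algebra homomorphisms exist by triangularity. A left inverse that itself has
  a left inverse is two-sided, and a two-sided inverse is unique among all linear maps.
\<close>

lemma antipode:
  shows alg_hom_antipode: "unital_alg_hom antipode"
    and antipode_conv_id: "antipode \<star> (\<lambda>x. x) = eps"
    and id_conv_antipode: "(\<lambda>x. x) \<star> antipode = eps"
proof -
  have left_inverse: "\<exists>g. unital_alg_hom g \<and> g \<star> f = eps" if f: "unital_alg_hom f" for f :: "alg \<Rightarrow> alg"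
  proof -
    have "\<exists>g. \<forall>\<tau>. (alg_ext g \<star> f) (tree \<tau>) = 0"
    proof (rule triangular_solve[of 1 "\<lambda>g \<tau>. (alg_ext g \<star> f) (tree \<tau>)" "\<lambda>_. 0"])
      fix g g' :: "rtree \<Rightarrow> alg" and \<tau>
      assume "\<And>\<sigma>. vertices \<sigma> < vertices \<tau> \<Longrightarrow> g \<sigma> = g' \<sigma>"
      then have "agree_below (vertices \<tau>) (alg_ext g) (alg_ext g')" by (rule agree_below_alg_ext)
      moreover have "agree_below (vertices \<tau>) f f" by (simp add: agree_below_def)
      ultimately show "(alg_ext g \<star> f) (tree \<tau>) - (alg_ext g' \<star> f) (tree \<tau>) = 1 *\<^sub>R (g \<tau> - g' \<tau>)"
        using conv_diff[OF alg_hom_alg_ext[of g] alg_hom_alg_ext[of g'] f f] by simp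
    qed simp
    then obtain g where "\<And>\<tau>. (alg_ext g \<star> f) (tree \<tau>) = 0" by blast
    then have "alg_ext g \<star> f = eps"
      by (intro alg_hom_eqI alg_hom_conv alg_hom_alg_ext f alg_hom_eps) simp
    then show ?thesis using alg_hom_alg_ext by blast
  qed
  obtain S where S: "unital_alg_hom S" "S \<star> (\<lambda>x. x) = (eps :: alg \<Rightarrow> alg)"
    using left_inverse[OF alg_hom_id] by blast
  obtain T where T: "unital_alg_hom T" "T \<star> S = (eps :: alg \<Rightarrow> alg)"
    using left_inverse[OF S(1)] by blast
  have "T = T \<star> (S \<star> (\<lambda>x. x))" using T(1) by (simp add: S(2) eps_conv alg_hom_linear)
  also have "\<dots> = (\<lambda>x. x)"
    by (simp add: T(2) eps_conv linear_ident flip: conv_assoc)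
  finally have idS: "(\<lambda>x. x) \<star> S = (eps :: alg \<Rightarrow> alg)" using T(2) by simp
  have "antipode = S"
    unfolding antipode_def convolution_eq counit_eq_eps id_def
  proof (rule the_equality)
    show "linear S \<and> S \<star> (\<lambda>x. x) = eps \<and> (\<lambda>x. x) \<star> S = eps"
      using S idS alg_hom_linear by blast
    fix S' :: "alg \<Rightarrow> alg"
    assume S': "linear S' \<and> S' \<star> (\<lambda>x. x) = eps \<and> (\<lambda>x. x) \<star> S' = eps"
    have "S' = S' \<star> ((\<lambda>x. x) \<star> S)" using S' by (simp add: idS eps_conv)
    also have "\<dots> = S"
      using S' S(1) by (simp add: eps_conv alg_hom_linear flip: conv_assoc)
    finally show "S' = S" .
  qed
  then show "unital_alg_hom antipode" "antipode \<star> (\<lambda>x. x) = eps" "(\<lambda>x. x) \<star> antipode = eps"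
    using S idS by simp_all
qed

definition inv_hom :: "(alg \<Rightarrow> 'b) \<Rightarrow> alg \<Rightarrow> 'b" where
  "inv_hom f x = f (antipode x)"

lemma alg_hom_inv_hom: "unital_alg_hom f \<Longrightarrow> unital_alg_hom (inv_hom f)"
  unfolding inv_hom_def[abs_def] by (rule alg_hom_comp[OF _ alg_hom_antipode])

lemma inv_hom_conv:
  assumes "unital_alg_hom f"
  shows "inv_hom f \<star> f = eps" "f \<star> inv_hom f = eps"
proof -
  have "f ((antipode \<star> (\<lambda>x. x)) x) = (inv_hom f \<star> f) x"
    "f (((\<lambda>x. x) \<star> antipode) x) = (f \<star> inv_hom f) x" for x
    by (simp_all only: comp_conv[OF assms] inv_hom_def[abs_def])
  then show "inv_hom f \<star> f = eps" "f \<star> inv_hom f = eps"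
    using assms by (auto simp: antipode_conv_id id_conv_antipode alg_hom_comp_eps)
qed

lemma inv_hom_unique:
  fixes f g :: "alg \<Rightarrow> 'b::{real_algebra_1,comm_ring_1}"
  assumes "unital_alg_hom f" "unital_alg_hom g" "f \<star> g = eps"
  shows "inv_hom f = g"
proof -
  have "inv_hom f = inv_hom f \<star> (f \<star> g)"
    using assms by (simp add: eps_conv alg_hom_linear alg_hom_inv_hom)
  also have "\<dots> = g"
    by (simp only: conv_assoc[symmetric] inv_hom_conv[OF assms(1)]
        eps_conv[OF alg_hom_linear[OF assms(2)]])
  finally show ?thesis .
qed

lemma inv_hom_inv_hom:
  fixes f :: "alg \<Rightarrow> 'b::{real_algebra_1,comm_ring_1}"
  assumes "unital_alg_hom f"
  shows "inv_hom (inv_hom f) = f"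
  using assms by (intro inv_hom_unique alg_hom_inv_hom inv_hom_conv)

lemma inv_hom_mult:
  fixes f g :: "alg \<Rightarrow> 'b::{real_algebra_1,comm_ring_1}"
  assumes f: "unital_alg_hom f" and g: "unital_alg_hom g"
  shows "inv_hom (f \<star> g) = inv_hom g \<star> inv_hom f"
proof (rule inv_hom_unique)
  have "(f \<star> g) \<star> (inv_hom g \<star> inv_hom f) = f \<star> ((g \<star> inv_hom g) \<star> inv_hom f)"
    by (simp only: conv_assoc)
  then show "(f \<star> g) \<star> (inv_hom g \<star> inv_hom f) = eps"
    using assms by (simp add: inv_hom_conv eps_conv alg_hom_linear alg_hom_inv_hom)
qed (intro alg_hom_conv alg_hom_inv_hom f g)+

lemma inv_hom_diff:
  fixes f f' :: "alg \<Rightarrow> 'b::{real_algebra_1,comm_ring_1}"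
  assumes hom: "unital_alg_hom f" "unital_alg_hom f'"
  shows "agree_below (vertices \<tau>) f f' \<Longrightarrow>
    inv_hom f (tree \<tau>) - inv_hom f' (tree \<tau>) = f' (tree \<tau>) - f (tree \<tau>)"
proof (induction "vertices \<tau>" arbitrary: \<tau> rule: less_induct)
  case less
  have "agree_below (vertices \<tau>) (inv_hom f) (inv_hom f')"
    unfolding agree_below_def
  proof (intro allI impI)
    fix \<sigma> assume *: "vertices \<sigma> < vertices \<tau>"
    then have "agree_below (vertices \<sigma>) f f'" "f (tree \<sigma>) = f' (tree \<sigma>)"
      using less.prems by (auto simp: agree_below_def)
    then show "inv_hom f (tree \<sigma>) = inv_hom f' (tree \<sigma>)" using less.hyps[OF *] by simp
  qed
  from conv_diff[OF hom alg_hom_inv_hom[OF hom(1)] alg_hom_inv_hom[OF hom(2)] less.prems this]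
  show ?case using hom by (simp add: inv_hom_conv algebra_simps)
qed

lemma agree_below_inv_hom:
  fixes f f' :: "alg \<Rightarrow> 'b::{real_algebra_1,comm_ring_1}"
  assumes hom: "unital_alg_hom f" "unital_alg_hom f'" and agree: "agree_below k f f'"
  shows "agree_below k (inv_hom f) (inv_hom f')"
  unfolding agree_below_def
proof (intro allI impI)
  fix \<tau> assume "vertices \<tau> < k"
  then have "agree_below (vertices \<tau>) f f'" "f (tree \<tau>) = f' (tree \<tau>)"
    using agree by (auto simp: agree_below_def)
  with inv_hom_diff[OF hom this(1)] show "inv_hom f (tree \<tau>) = inv_hom f' (tree \<tau>)" by simp
qed

lemma double_eq_0D: "x + x = 0 \<Longrightarrow> x = 0" for x :: "'b::real_vector"
  by (metis scaleR_2 scaleR_eq_0_iff zero_neq_numeral)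

text \<open>
  At \<open>\<tau>\<close> the square \<open>q \<star> q\<close> is \<open>2 q \<tau>\<close> plus terms in smaller trees, so it determines \<open>q\<close>.
\<close>

lemma agree_below_sqrt:
  fixes q q' :: "alg \<Rightarrow> 'b::{real_algebra_1,comm_ring_1}"
  assumes hom: "unital_alg_hom q" "unital_alg_hom q'"
    and agree: "agree_below k (q \<star> q) (q' \<star> q')"
  shows "agree_below k q q'"
proof -
  have "q (tree \<tau>) = q' (tree \<tau>)" if "vertices \<tau> < k" for \<tau>
    using that
  proof (induction "vertices \<tau>" arbitrary: \<tau> rule: less_induct)
    case less
    then have *: "agree_below (vertices \<tau>) q q'" by (auto simp: agree_below_def)
    have "(q \<star> q) (tree \<tau>) = (q' \<star> q') (tree \<tau>)"
      using agree less.prems by (simp add: agree_below_def)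
    with conv_diff[OF hom hom * *]
    have "(q (tree \<tau>) - q' (tree \<tau>)) + (q (tree \<tau>) - q' (tree \<tau>)) = 0" by simp
    from double_eq_0D[OF this] show ?case by simp
  qed
  then show ?thesis by (simp add: agree_below_def)
qed

lemma sqrt_unique:
  fixes q q' :: "alg \<Rightarrow> 'b::{real_algebra_1,comm_ring_1}"
  assumes hom: "unital_alg_hom q" "unital_alg_hom q'" and "q \<star> q = q' \<star> q'"
  shows "q = q'"
proof (rule alg_hom_eqI[OF hom])
  fix \<tau>
  have "agree_below (Suc (vertices \<tau>)) q q'"
    by (rule agree_below_sqrt[OF hom]) (simp add: agree_below_def assms(3))
  then show "q (tree \<tau>) = q' (tree \<tau>)" by (simp add: agree_below_def)
qed

text \<open>
  The equation for the square root at \<open>\<tau>\<close> has leading coefficient \<open>2\<close>.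
\<close>

lemma id_half:
  shows alg_hom_id_half: "unital_alg_hom id_half"
    and id_half_conv_id_half: "id_half \<star> id_half = (\<lambda>x. x)"
proof -
  have "\<exists>g. \<forall>\<tau>. (alg_ext g \<star> alg_ext g) (tree \<tau>) = tree \<tau>"
  proof (rule triangular_solve[of 2 "\<lambda>g \<tau>. (alg_ext g \<star> alg_ext g) (tree \<tau>)" tree])
    fix g g' :: "rtree \<Rightarrow> alg" and \<tau>
    assume "\<And>\<sigma>. vertices \<sigma> < vertices \<tau> \<Longrightarrow> g \<sigma> = g' \<sigma>"
    then have *: "agree_below (vertices \<tau>) (alg_ext g) (alg_ext g')" by (rule agree_below_alg_ext)
    show "(alg_ext g \<star> alg_ext g) (tree \<tau>) - (alg_ext g' \<star> alg_ext g') (tree \<tau>) = 2 *\<^sub>R (g \<tau> - g' \<tau>)"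
      using conv_diff[OF alg_hom_alg_ext[of g] alg_hom_alg_ext[of g'] alg_hom_alg_ext[of g] alg_hom_alg_ext[of g'] * *]
      by (simp add: scaleR_2)
  qed simp
  then obtain g where "\<And>\<tau>. (alg_ext g \<star> alg_ext g) (tree \<tau>) = tree \<tau>" by blast
  then have sqrt: "alg_ext g \<star> alg_ext g = (\<lambda>x. x)"
    by (intro alg_hom_eqI alg_hom_conv alg_hom_alg_ext alg_hom_id)
  have eq: "id_half = alg_ext g"
    unfolding id_half_def convolution_eq id_def
  proof (rule the_equality)
    show "unital_alg_hom (alg_ext g) \<and> alg_ext g \<star> alg_ext g = (\<lambda>x. x)"
      using sqrt alg_hom_alg_ext by blast
    fix h assume "unital_alg_hom h \<and> h \<star> h = (\<lambda>x. x :: alg)"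
    then show "h = alg_ext g"
      by (intro sqrt_unique[OF _ alg_hom_alg_ext, of h g]) (simp_all only: sqrt)
  qed
  show "unital_alg_hom id_half" unfolding eq by (rule alg_hom_alg_ext)
  show "id_half \<star> id_half = (\<lambda>x. x)" unfolding eq by (rule sqrt)
qed


section \<open>The maps plus and minus on characters\<close>

text \<open>
  The grading automorphism of \<open>alg\<close>. On elementary weights it amounts to negating the step size.
\<close>

definition alternate :: "alg \<Rightarrow> alg" where
  "alternate = lin_ext (\<lambda>F. (-1) ^ forest_vertices F *\<^sub>R basis F)"

definition bar :: "(alg \<Rightarrow> 'b) \<Rightarrow> alg \<Rightarrow> 'b" where
  "bar f x = f (alternate x)"

lemma alg_hom_alternate: "unital_alg_hom alternate"
  unfolding alternate_def
  by (rule unital_alg_hom_lin_ext) (simp_all add: basis_empty basis_plus power_add del: single_add)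

lemma alg_hom_bar: "unital_alg_hom f \<Longrightarrow> unital_alg_hom (bar f)"
  unfolding bar_def[abs_def] by (rule alg_hom_comp[OF _ alg_hom_alternate])

lemma bar_basis: "linear f \<Longrightarrow> bar f (basis F) = (-1) ^ forest_vertices F *\<^sub>R f (basis F)"
  by (simp add: bar_def alternate_def linear_scale)

lemma bar_tree: "linear f \<Longrightarrow> bar f (tree \<tau>) = (-1) ^ vertices \<tau> *\<^sub>R f (tree \<tau>)"
  by (simp add: bar_basis)

lemma bar_bar:
  fixes f :: "alg \<Rightarrow> 'b::{real_algebra_1,comm_ring_1}"
  assumes "unital_alg_hom f"
  shows "bar (bar f) = f"
  using assms
  by (intro alg_hom_eqI alg_hom_bar) (simp_all add: bar_tree alg_hom_linear alg_hom_bar flip: power_add)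

lemma bar_eps: "bar eps = eps"
  by (intro alg_hom_eqI alg_hom_bar alg_hom_eps) (simp_all add: bar_tree alg_hom_linear alg_hom_eps)

text \<open>
  The coproduct preserves the total number of vertices, hence \<open>bar\<close> is an automorphism of the
  group of characters.
\<close>

lemma bar_conv:
  fixes f g :: "alg \<Rightarrow> 'b::{real_algebra_1,comm_ring_1}"
  assumes f: "unital_alg_hom f" and g: "unital_alg_hom g"
  shows "bar (f \<star> g) = bar f \<star> bar g"
proof (rule alg_hom_eqI)
  fix \<tau>
  obtain C :: "nat list set set" and P R where cop:
    "coprod_tree \<tau> = basis ({#\<tau>#}, {#}) + basis ({#}, {#\<tau>#}) + (\<Sum>c\<in>C. basis (P c, R c))"
    and size: "\<And>c. c \<in> C \<Longrightarrow> forest_vertices (P c) + forest_vertices (R c) = vertices \<tau>"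
    and "\<And>c. c \<in> C \<Longrightarrow> forest_vertices (P c) < vertices \<tau>"
      "\<And>c. c \<in> C \<Longrightarrow> forest_vertices (R c) < vertices \<tau>"
    by (rule coprod_tree_graded[of \<tau>]) (rule that, assumption+)
  have formula: "(u \<star> v) (tree \<tau>) = u (tree \<tau>) + v (tree \<tau>) + (\<Sum>c\<in>C. u (basis (P c)) * v (basis (R c)))"
    if "unital_alg_hom u" "unital_alg_hom v" for u v :: "alg \<Rightarrow> 'b"
    using that by (simp add: conv_def cop lin_ext_add lin_ext_sum basis_empty alg_hom_one)
  have "(\<Sum>c\<in>C. bar f (basis (P c)) * bar g (basis (R c))) =
      (\<Sum>c\<in>C. (-1) ^ vertices \<tau> *\<^sub>R (f (basis (P c)) * g (basis (R c))))"
    using f g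
    by (intro sum.cong) (simp_all add: bar_basis alg_hom_linear power_add mult.commute flip: size)
  then show "bar (f \<star> g) (tree \<tau>) = (bar f \<star> bar g) (tree \<tau>)"
    using f g
    by (simp add: formula bar_tree linear_conv alg_hom_bar alg_hom_linear scaleR_add_right scaleR_sum_right)
qed (intro alg_hom_conv alg_hom_bar f g)+

lemma bar_inv_hom:
  fixes f :: "alg \<Rightarrow> 'b::{real_algebra_1,comm_ring_1}"
  assumes f: "unital_alg_hom f"
  shows "bar (inv_hom f) = inv_hom (bar f)"
proof (rule inv_hom_unique[symmetric])
  show "bar f \<star> bar (inv_hom f) = eps"
    using f by (simp add: bar_eps inv_hom_conv alg_hom_inv_hom flip: bar_conv)
qed (intro alg_hom_bar alg_hom_inv_hom f)+

lemma antipode_bar_eq: "antipode_bar = (\<lambda>x. antipode (alternate x))"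
proof
  fix x
  show "antipode_bar x = antipode (alternate x)"
    unfolding antipode_bar_def alternate_def lin_ext_lin_ext[OF alg_hom_linear[OF alg_hom_antipode]]
    by (simp add: linear_scale[OF alg_hom_linear[OF alg_hom_antipode]])
qed

definition minus_part :: "(alg \<Rightarrow> 'b) \<Rightarrow> alg \<Rightarrow> 'b" where
  "minus_part f x = f (minus_map x)"

definition plus_part :: "(alg \<Rightarrow> 'b) \<Rightarrow> alg \<Rightarrow> 'b" where
  "plus_part f x = f (plus_map x)"

lemma minus_map_eq: "minus_map = (\<lambda>x. (antipode_bar \<star> (\<lambda>x. x)) (id_half x))"
  by (simp add: minus_map_def convolution_eq comp_def id_def)

lemma alg_hom_minus_map: "unital_alg_hom minus_map"
  unfolding minus_map_eq antipode_bar_eq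
  by (intro alg_hom_comp[OF alg_hom_conv alg_hom_id_half] alg_hom_id
      alg_hom_comp[OF alg_hom_antipode alg_hom_alternate])

lemma alg_hom_minus_part: "unital_alg_hom f \<Longrightarrow> unital_alg_hom (minus_part f)"
  unfolding minus_part_def[abs_def] by (rule alg_hom_comp[OF _ alg_hom_minus_map])

text \<open>
  Composition with \<open>id_half\<close> is the square root in the group of characters, and composition with
  \<open>antipode_bar\<close> sends \<open>f\<close> to the inverse of \<open>bar f\<close>. So the minus part of \<open>f\<close> is the square root of
  \<open>(bar f)\<^bsup>-1\<^esup> \<star> f\<close>.
\<close>

lemma minus_part_square:
  fixes f :: "alg \<Rightarrow> 'b::{real_algebra_1,comm_ring_1}"
  assumes f: "unital_alg_hom f"
  shows "minus_part f \<star> minus_part f = inv_hom (bar f) \<star> f"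
proof -
  let ?r = "inv_hom (bar f) \<star> f"
  have r: "unital_alg_hom ?r" by (intro alg_hom_conv alg_hom_inv_hom alg_hom_bar f)
  have "?r = bar (inv_hom f) \<star> f" by (simp only: bar_inv_hom[OF f])
  then have "minus_part f x = ?r (id_half x)" for x
    by (simp add: minus_part_def minus_map_eq comp_conv[OF f] antipode_bar_eq bar_def[abs_def]
        inv_hom_def[abs_def])
  then have eq: "minus_part f = (\<lambda>x. ?r (id_half x))" by blast
  show ?thesis
    by (rule ext) (simp only: eq comp_conv[OF r, of id_half id_half, symmetric] id_half_conv_id_half)
qed

lemma plus_part_eq:
  fixes f :: "alg \<Rightarrow> 'b::{real_algebra_1,comm_ring_1}"
  assumes f: "unital_alg_hom f"
  shows "plus_part f = f \<star> inv_hom (minus_part f)"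
proof
  fix x show "plus_part f x = (f \<star> inv_hom (minus_part f)) x"
    by (simp add: plus_part_def plus_map_def convolution_eq comp_conv[OF f] comp_def id_def
        inv_hom_def[abs_def] minus_part_def)
qed

lemma alg_hom_plus_part:
  fixes f :: "alg \<Rightarrow> 'b::{real_algebra_1,comm_ring_1}"
  assumes "unital_alg_hom f"
  shows "unital_alg_hom (plus_part f)"
  unfolding plus_part_eq[OF assms]
  by (intro alg_hom_conv alg_hom_inv_hom alg_hom_minus_part assms)

text \<open>
  Applying \<open>bar\<close> to \<open>(bar f)\<^bsup>-1\<^esup> \<star> f\<close> gives \<open>f\<^bsup>-1\<^esup> \<star> bar f\<close>, which is its inverse. Square roots being
  unique, the same holds for the square roots.
\<close>

lemma bar_minus_part:
  fixes f :: "alg \<Rightarrow> 'b::{real_algebra_1,comm_ring_1}"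
  assumes f: "unital_alg_hom f"
  shows "bar (minus_part f) = inv_hom (minus_part f)"
proof (rule sqrt_unique)
  let ?q = "minus_part f"
  have q: "unital_alg_hom ?q" by (rule alg_hom_minus_part[OF f])
  have "bar ?q \<star> bar ?q = bar (inv_hom (bar f) \<star> f)"
    by (simp only: bar_conv[OF q q, symmetric] minus_part_square[OF f])
  also have "\<dots> = inv_hom f \<star> bar f"
    by (simp only: bar_conv[OF alg_hom_inv_hom[OF alg_hom_bar[OF f]] f]
        bar_inv_hom[OF alg_hom_bar[OF f]] bar_bar[OF f])
  also have "\<dots> = inv_hom (inv_hom (bar f) \<star> f)"
    by (simp only: inv_hom_mult[OF alg_hom_inv_hom[OF alg_hom_bar[OF f]] f]
        inv_hom_inv_hom[OF alg_hom_bar[OF f]])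
  also have "\<dots> = inv_hom ?q \<star> inv_hom ?q"
    by (simp only: minus_part_square[OF f, symmetric] inv_hom_mult[OF q q])
  finally show "bar ?q \<star> bar ?q = inv_hom ?q \<star> inv_hom ?q" .
  show "unital_alg_hom (bar ?q)" "unital_alg_hom (inv_hom ?q)"
    by (intro alg_hom_bar alg_hom_inv_hom q)+
qed

text \<open>
  With \<open>q\<close> the minus part, \<open>bar (f \<star> q\<^bsup>-1\<^esup>) = bar f \<star> q\<close>, and \<open>q \<star> q = (bar f)\<^bsup>-1\<^esup> \<star> f\<close> turns this
  into \<open>f \<star> q\<^bsup>-1\<^esup>\<close>.
\<close>

lemma bar_plus_part:
  fixes f :: "alg \<Rightarrow> 'b::{real_algebra_1,comm_ring_1}"
  assumes f: "unital_alg_hom f"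
  shows "bar (plus_part f) = plus_part f"
proof -
  let ?q = "minus_part f"
  have q: "unital_alg_hom ?q" by (rule alg_hom_minus_part[OF f])
  have "bar (plus_part f) = bar f \<star> ?q"
    by (simp only: plus_part_eq[OF f] bar_conv[OF f alg_hom_inv_hom[OF q]]
        bar_inv_hom[OF q] bar_minus_part[OF f] inv_hom_inv_hom[OF q])
  also have "\<dots> = bar f \<star> (?q \<star> (?q \<star> inv_hom ?q))"
    by (simp only: inv_hom_conv[OF q] eps_conv[OF alg_hom_linear[OF q]])
  also have "\<dots> = bar f \<star> ((?q \<star> ?q) \<star> inv_hom ?q)"
    by (simp only: conv_assoc)
  also have "\<dots> = (bar f \<star> inv_hom (bar f)) \<star> (f \<star> inv_hom ?q)"
    by (simp only: minus_part_square[OF f] conv_assoc)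
  also have "\<dots> = plus_part f"
    by (simp only: inv_hom_conv[OF alg_hom_bar[OF f]] eps_conv[OF linear_conv] plus_part_eq[OF f])
  finally show ?thesis .
qed

text \<open>
  The fixed points of \<open>bar\<close> are the characters that vanish on trees of odd size. This is why
  antisymmetric orders are odd.
\<close>

theorem plus_part_odd:
  fixes f :: "alg \<Rightarrow> 'b::{real_algebra_1,comm_ring_1}"
  assumes f: "unital_alg_hom f" and odd: "odd (vertices \<tau>)"
  shows "plus_part f (tree \<tau>) = 0"
proof -
  have "bar (plus_part f) (tree \<tau>) = - plus_part f (tree \<tau>)"
    using odd by (simp add: bar_tree alg_hom_linear alg_hom_plus_part f)
  then have "plus_part f (tree \<tau>) + plus_part f (tree \<tau>) = 0"
    by (simp add: bar_plus_part[OF f])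
  then show ?thesis by (rule double_eq_0D)
qed

text \<open>
  For \<open>\<tau>\<close> of even size, \<open>(bar f)\<^bsup>-1\<^esup> \<star> f\<close> has leading term \<open>- f \<tau> + f \<tau> = 0\<close> at \<open>\<tau>\<close>. So its square
  root, the minus part, is determined at \<open>\<tau>\<close> by smaller trees, and \<open>f \<tau>\<close> survives in the plus
  part with coefficient \<open>1\<close>.
\<close>

theorem plus_part_diff:
  fixes f f' :: "alg \<Rightarrow> 'b::{real_algebra_1,comm_ring_1}"
  assumes hom: "unital_alg_hom f" "unital_alg_hom f'" and even: "even (vertices \<tau>)"
    and agree: "agree_below (vertices \<tau>) f f'"
  shows "plus_part f (tree \<tau>) - plus_part f' (tree \<tau>) = f (tree \<tau>) - f' (tree \<tau>)"
proof -
  let ?k = "vertices \<tau>"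
  let ?q = "minus_part f" and ?q' = "minus_part f'"
  let ?i = "inv_hom (bar f)" and ?i' = "inv_hom (bar f')"
  have agree_bar: "agree_below ?k (bar f) (bar f')"
    using agree by (simp add: agree_below_def bar_tree alg_hom_linear hom)
  note bars = alg_hom_bar[OF hom(1)] alg_hom_bar[OF hom(2)]
  note invs = alg_hom_inv_hom[OF bars(1)] alg_hom_inv_hom[OF bars(2)]
  note q = alg_hom_minus_part[OF hom(1)] alg_hom_minus_part[OF hom(2)]
  have "(?i \<star> f) (tree \<sigma>) = (?i' \<star> f') (tree \<sigma>)" if "vertices \<sigma> < Suc ?k" for \<sigma>
  proof (cases "vertices \<sigma> = ?k")
    case True
    note agree' = agree[folded True] agree_bar[folded True]
    show ?thesis
      using conv_diff[OF invs hom agree_below_inv_hom[OF bars agree'(2)] agree'(1)]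
        inv_hom_diff[OF bars agree'(2)] even
      by (simp add: bar_tree alg_hom_linear hom True)
  next
    case False
    then show ?thesis
      using agree_below_conv[OF invs hom agree_below_inv_hom[OF bars agree_bar] agree] that
      by (simp add: agree_below_def)
  qed
  then have "agree_below (Suc ?k) (?q \<star> ?q) (?q' \<star> ?q')"
    by (simp add: agree_below_def minus_part_square hom)
  then have "agree_below (Suc ?k) ?q ?q'" by (rule agree_below_sqrt[OF q])
  then have agree_q: "agree_below ?k ?q ?q'" and q_eq: "?q (tree \<tau>) = ?q' (tree \<tau>)"
    by (simp_all add: agree_below_def)
  show ?thesis
    using conv_diff[OF hom alg_hom_inv_hom[OF q(1)] alg_hom_inv_hom[OF q(2)] agree
        agree_below_inv_hom[OF q agree_q]] inv_hom_diff[OF q agree_q] q_eq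
    by (simp add: plus_part_eq hom)
qed

theorem plus_part_symmetric:
  fixes f :: "alg \<Rightarrow> 'b::{real_algebra_1,comm_ring_1}"
  assumes f: "unital_alg_hom f" and symm: "bar f \<star> f = eps"
  shows "plus_part f = eps"
proof -
  have "inv_hom (bar f) = f" by (rule inv_hom_unique[OF alg_hom_bar[OF f] f symm])
  then have "minus_part f \<star> minus_part f = f \<star> f" by (simp only: minus_part_square[OF f])
  then have "minus_part f = f" by (rule sqrt_unique[OF alg_hom_minus_part[OF f] f])
  then show ?thesis by (simp only: plus_part_eq[OF f] inv_hom_conv[OF f])
qed


section \<open>The exact flow\<close>

text \<open>
  The B-series coefficients of the exact solution of an ordinary differential equation at time
  \<open>t\<close>.
\<close>

definition flow :: "real \<Rightarrow> alg \<Rightarrow> real" where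
  "flow t = alg_ext (\<lambda>\<tau>. t ^ vertices \<tau> / real (tree_fact \<tau>))"

lemma alg_hom_flow: "unital_alg_hom (flow t)"
  by (simp add: flow_def alg_hom_alg_ext)

lemma flow_basis: "flow t (basis F) = t ^ forest_vertices F / real (\<Prod>\<^sub># (image_mset tree_fact F))"
  by (induction F) (simp_all add: flow_def alg_ext_basis power_add alg_hom_one[OF alg_hom_alg_ext])

lemma flow_tree: "flow t (tree \<tau>) = t ^ vertices \<tau> / real (tree_fact \<tau>)"
  by (simp add: flow_basis)

lemma flow_zero: "flow 0 (tree \<tau>) = 0"
  by (simp add: flow_tree)

text \<open>
  The flow is the Picard integral: \<open>flow t (B\<^sub>+ M)\<close> integrates \<open>flow u M\<close> over \<open>u\<close> from \<open>0\<close> to \<open>t\<close>.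
\<close>

lemma has_derivative_flow_Node:
  "((\<lambda>t. flow t (tree (Node M))) has_real_derivative flow t (basis M)) (at t)"
proof -
  let ?n = "forest_vertices M"
  have "((\<lambda>t::real. t ^ Suc ?n / (real (Suc ?n) * real (\<Prod>\<^sub># (image_mset tree_fact M))))
      has_real_derivative t ^ ?n / real (\<Prod>\<^sub># (image_mset tree_fact M))) (at t)"
    using DERIV_cdivide[OF DERIV_pow[of "Suc ?n" t],
        of "real (Suc ?n) * real (\<Prod>\<^sub># (image_mset tree_fact M))"]
    by (simp del: of_nat_Suc power_Suc)
  then show ?thesis by (simp add: flow_basis distrib_right)
qed

lemma has_derivative_conv_flow:
  "((\<lambda>t. (f \<star> (\<lambda>x. flow t (add_root x))) x) has_real_derivative (f \<star> flow t) x) (at t)"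
  unfolding conv_def lin_ext_def case_prod_unfold add_root_basis real_scaleR_def
  by (intro DERIV_sum DERIV_cmult has_derivative_flow_Node)

text \<open>
  Flows compose. At \<open>Node M\<close>, both sides have the same value for \<open>t = 0\<close>, and by the cocycle
  property their derivatives in \<open>t\<close> are the two sides at the forest \<open>M\<close>, which agree by induction.
\<close>

theorem flow_conv: "flow s \<star> flow t = flow (s + t)"
proof -
  have "(flow s \<star> flow t) (tree \<tau>) = flow (s + t) (tree \<tau>)" for \<tau> t
  proof (induction \<tau> arbitrary: t)
    case (Node M)
    let ?D = "\<lambda>t. (flow s \<star> flow t) (tree (Node M)) - flow (s + t) (tree (Node M))"
    have IH: "(flow s \<star> flow t) (basis M) = flow (s + t) (basis M)" for t
      by (rule alg_hom_eq_on_basis[OF alg_hom_conv[OF alg_hom_flow alg_hom_flow] alg_hom_flow Node.IH])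
    have node: "(flow s \<star> flow t) (tree (Node M)) =
        flow s (tree (Node M)) + (flow s \<star> (\<lambda>x. flow t (add_root x))) (basis M)" for t
      by (rule conv_Node[of "flow t" "flow s", OF alg_hom_one[OF alg_hom_flow]])
    have "(?D has_real_derivative 0) (at t)" for t
    proof -
      have "((\<lambda>t. flow (s + t) (tree (Node M))) has_real_derivative flow (s + t) (basis M)) (at t)"
        using has_derivative_flow_Node[of M "t + s", unfolded DERIV_shift] by (simp add: add.commute)
      then have "(?D has_real_derivative (0 + (flow s \<star> flow t) (basis M)) - flow (s + t) (basis M)) (at t)"
        unfolding node by (intro DERIV_diff DERIV_add DERIV_const has_derivative_conv_flow)
      then show ?thesis by (simp add: IH)
    qed
    then have "?D t = ?D 0" by (intro DERIV_isconst_all) blast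
    moreover have "flow 0 = eps"
      by (intro alg_hom_eqI alg_hom_flow alg_hom_eps) (simp add: flow_zero)
    ultimately show ?case by (simp add: eps_conv alg_hom_linear alg_hom_flow)
  qed
  then show ?thesis by (intro alg_hom_eqI alg_hom_conv alg_hom_flow)
qed

theorem plus_part_flow: "plus_part (flow 1) = eps"
proof (rule plus_part_symmetric[OF alg_hom_flow])
  have "bar (flow 1) = flow (-1)"
    by (intro alg_hom_eqI alg_hom_bar alg_hom_flow)
       (simp add: bar_tree alg_hom_linear alg_hom_flow flow_tree)
  then have "bar (flow 1) \<star> flow 1 = flow 0" by (simp add: flow_conv)
  also have "flow 0 = eps"
    by (intro alg_hom_eqI alg_hom_flow alg_hom_eps) (simp add: flow_zero)
  finally show "bar (flow 1) \<star> flow 1 = eps" .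
qed


section \<open>A target character\<close>

text \<open>
  The conditions form a triangular system with leading coefficient \<open>1\<close>: trivially so at odd
  trees, and by \<open>plus_part_diff\<close> at even ones.
\<close>

theorem ex_character_with_plus_part:
  fixes g\<^sub>0 t :: "rtree \<Rightarrow> real"
  shows "\<exists>g. (\<forall>\<tau>. odd (vertices \<tau>) \<longrightarrow> g \<tau> = g\<^sub>0 \<tau>) \<and>
    (\<forall>\<tau>. even (vertices \<tau>) \<longrightarrow> plus_part (alg_ext g) (tree \<tau>) = t \<tau>)"
proof -
  let ?\<Phi> = "\<lambda>g \<tau>. if odd (vertices \<tau>) then g \<tau> else plus_part (alg_ext g) (tree \<tau>) :: real"
  have "\<exists>g. \<forall>\<tau>. ?\<Phi> g \<tau> = (if odd (vertices \<tau>) then g\<^sub>0 \<tau> else t \<tau>)"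
  proof (rule triangular_solve[where c = 1])
    fix g g' :: "rtree \<Rightarrow> real" and \<tau>
    assume "\<And>\<sigma>. vertices \<sigma> < vertices \<tau> \<Longrightarrow> g \<sigma> = g' \<sigma>"
    then have "agree_below (vertices \<tau>) (alg_ext g) (alg_ext g')" by (rule agree_below_alg_ext)
    from plus_part_diff[OF alg_hom_alg_ext alg_hom_alg_ext _ this]
    show "?\<Phi> g \<tau> - ?\<Phi> g' \<tau> = 1 *\<^sub>R (g \<tau> - g' \<tau>)" by simp
  qed simp
  then show ?thesis by (metis (full_types))
qed

text \<open>
  For a symmetric method, the order conditions for trees of odd size imply the others, since
  the exact flow is symmetric and a symmetric character is determined by its values on odd trees.
\<close>

theorem symmetric_order_conditions:
  assumes odd: "\<And>\<tau>. odd (vertices \<tau>) \<Longrightarrow> vertices \<tau> \<le> n \<Longrightarrow> g \<tau> = 1 / real (tree_fact \<tau>)"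
    and even: "\<And>\<tau>. even (vertices \<tau>) \<Longrightarrow> vertices \<tau> \<le> n \<Longrightarrow> plus_part (alg_ext g) (tree \<tau>) = 0"
  shows "vertices \<tau> \<le> n \<Longrightarrow> g \<tau> = 1 / real (tree_fact \<tau>)"
proof (induction "vertices \<tau>" arbitrary: \<tau> rule: less_induct)
  case less
  show ?case
  proof (cases "even (vertices \<tau>)")
    case True
    have "agree_below (vertices \<tau>) (alg_ext g) (flow 1)"
      using less by (simp add: agree_below_def flow_tree)
    from plus_part_diff[OF alg_hom_alg_ext alg_hom_flow True this]
    show ?thesis using even[OF True less.prems] by (simp add: plus_part_flow flow_tree)
  next
    case False
    then show ?thesis using odd less.prems by simp
  qed
qed


section \<open>Elementary weights of explicit schemes\<close>

lemma finite_trees: "finite {\<tau>. vertices \<tau> \<le> N}"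
proof (induction N)
  case 0
  then show ?case by simp
next
  case (Suc N)
  let ?T = "{\<tau>. vertices \<tau> \<le> N}"
  have size: "size M \<le> forest_vertices M" for M
  proof (induction M)
    case (add \<tau> M)
    then show ?case using vertices_pos[of \<tau>] by (simp del: vertices_pos)
  qed simp
  have "{\<tau>. vertices \<tau> \<le> Suc N} \<subseteq> Node ` (\<Union>k\<le>N. {M. set_mset M \<subseteq> ?T \<and> size M = k})"
  proof
    fix \<tau> assume "\<tau> \<in> {\<tau>. vertices \<tau> \<le> Suc N}"
    then obtain M where M: "\<tau> = Node M" "forest_vertices M \<le> N" by (cases \<tau>) auto
    then have "set_mset M \<subseteq> ?T" using vertices_le_forest_vertices order_trans by blast
    moreover have "size M \<le> N" using size M(2) order_trans by blast
    ultimately show "\<tau> \<in> Node ` (\<Union>k\<le>N. {M. set_mset M \<subseteq> ?T \<and> size M = k})"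
      using M(1) by blast
  qed
  then show ?case
    by (rule finite_subset) (use finite_multisets_of_size[OF Suc.IH] in \<open>simp add: multisets_of_size_def\<close>)
qed

text \<open>
  Consistency is not imposed, since the sums and multiples formed below destroy it; it
  is the order condition for the one-vertex tree and is recovered at the end.
\<close>

definition explicit_weights :: "(rtree \<Rightarrow> real) set" where
  "explicit_weights = {tree_weight \<Psi> | \<Psi>. explicit_rk \<Psi>}"

lemma explicit_weightsI: "explicit_rk \<Psi> \<Longrightarrow> tree_weight \<Psi> = f \<Longrightarrow> f \<in> explicit_weights"
  by (auto simp: explicit_weights_def)

lemma zero_explicit_weights: "(\<lambda>_. 0) \<in> explicit_weights"
proof -
  let ?\<Psi> = "\<lparr>stages = 0, rk_a = (\<lambda>_ _. 0), rk_b = (\<lambda>_. 0)\<rparr>"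
  have "tree_weight ?\<Psi> = (\<lambda>_. 0)"
  proof
    fix \<tau> show "tree_weight ?\<Psi> \<tau> = 0" by (cases \<tau>) simp
  qed
  then show ?thesis by (rule explicit_weightsI[rotated]) (simp add: explicit_rk_def)
qed

text \<open>
  The two schemes are computed independently; their stages are listed one after the other.
\<close>

definition direct_sum :: "rk_scheme \<Rightarrow> rk_scheme \<Rightarrow> rk_scheme" where
  "direct_sum \<Psi> \<Phi> =
    (let s = stages \<Psi> in
     \<lparr>stages = s + stages \<Phi>,
      rk_a = (\<lambda>i j. if i \<le> s \<and> j \<le> s then rk_a \<Psi> i j
                    else if i > s \<and> j > s then rk_a \<Phi> (i - s) (j - s) else 0),
      rk_b = (\<lambda>i. if i \<le> s then rk_b \<Psi> i else rk_b \<Phi> (i - s))\<rparr>)"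

lemma direct_sum_sel:
  "stages (direct_sum \<Psi> \<Phi>) = stages \<Psi> + stages \<Phi>"
  "i \<le> stages \<Psi> \<Longrightarrow> rk_b (direct_sum \<Psi> \<Phi>) i = rk_b \<Psi> i"
  "1 \<le> i \<Longrightarrow> rk_b (direct_sum \<Psi> \<Phi>) (stages \<Psi> + i) = rk_b \<Phi> i"
  by (simp_all add: direct_sum_def Let_def)

lemma sum_split_stages:
  "(\<Sum>i = 1..s + r. f i) = (\<Sum>i = 1..s. f i) + (\<Sum>i = 1..r. f (s + i))"
  for f :: "nat \<Rightarrow> real"
proof -
  have "(\<Sum>i = 1..s + r. f i) = (\<Sum>i = 1..s. f i) + (\<Sum>i = Suc s..s + r. f i)"
    using sum.ub_add_nat[of 1 s f r] by simp
  also have "(\<Sum>i = Suc s..s + r. f i) = (\<Sum>i = 1..r. f (s + i))"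
    using sum.shift_bounds_cl_nat_ivl[of f 1 s r] by (simp add: add.commute)
  finally show ?thesis .
qed

lemma stage_weight_direct_sum:
  assumes "1 \<le> i"
  shows "i \<le> stages \<Psi> \<Longrightarrow> stage_weight (direct_sum \<Psi> \<Phi>) \<tau> i = stage_weight \<Psi> \<tau> i"
    and "stage_weight (direct_sum \<Psi> \<Phi>) \<tau> (stages \<Psi> + i) = stage_weight \<Phi> \<tau> i"
proof (atomize (full), insert assms, induction \<tau> arbitrary: i)
  case (Node M)
  let ?s = "stages \<Psi>" and ?D = "direct_sum \<Psi> \<Phi>"
  have left: "(\<Prod>\<tau>\<in>#M. stage_weight ?D \<tau> j) = (\<Prod>\<tau>\<in>#M. stage_weight \<Psi> \<tau> j)"
    if "j \<in> {1..?s}" for j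
    using Node.IH that by (intro arg_cong[where f = prod_mset] image_mset_cong) auto
  have right: "(\<Prod>\<tau>\<in>#M. stage_weight ?D \<tau> (?s + j)) = (\<Prod>\<tau>\<in>#M. stage_weight \<Phi> \<tau> j)"
    if "j \<in> {1..stages \<Phi>}" for j
    using Node.IH that by (intro arg_cong[where f = prod_mset] image_mset_cong) auto
  have "stage_weight ?D (Node M) k =
      (\<Sum>j = 1..?s. rk_a ?D k j * (\<Prod>\<tau>\<in>#M. stage_weight \<Psi> \<tau> j)) +
      (\<Sum>j = 1..stages \<Phi>. rk_a ?D k (?s + j) * (\<Prod>\<tau>\<in>#M. stage_weight \<Phi> \<tau> j))" for k
    by (simp only: stage_weight.simps direct_sum_sel(1) sum_split_stages)
       (intro arg_cong2[where f = "(+)"] sum.cong refl; simp add: left right)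
  then show ?case using Node.prems
    by (auto simp: direct_sum_def Let_def intro!: sum.neutral sum.cong)
qed

lemma tree_weight_direct_sum:
  "tree_weight (direct_sum \<Psi> \<Phi>) \<tau> = tree_weight \<Psi> \<tau> + tree_weight \<Phi> \<tau>"
proof (cases \<tau>)
  case (Node M)
  let ?s = "stages \<Psi>" and ?D = "direct_sum \<Psi> \<Phi>"
  have "tree_weight ?D (Node M) =
      (\<Sum>j = 1..?s. rk_b ?D j * (\<Prod>\<tau>\<in>#M. stage_weight ?D \<tau> j)) +
      (\<Sum>j = 1..stages \<Phi>. rk_b ?D (?s + j) * (\<Prod>\<tau>\<in>#M. stage_weight ?D \<tau> (?s + j)))"
    by (simp only: tree_weight.simps direct_sum_sel(1) sum_split_stages)
  also have "\<dots> = tree_weight \<Psi> (Node M) + tree_weight \<Phi> (Node M)"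
    unfolding tree_weight.simps
    by (intro arg_cong2[where f = "(+)"] sum.cong refl)
       (simp_all add: stage_weight_direct_sum direct_sum_sel)
  finally show ?thesis by (simp only: Node)
qed

lemma explicit_direct_sum:
  assumes "explicit_rk \<Psi>" "explicit_rk \<Phi>"
  shows "explicit_rk (direct_sum \<Psi> \<Phi>)"
  unfolding explicit_rk_def
proof (intro ballI impI)
  fix i j assume *: "i \<in> {1..stages (direct_sum \<Psi> \<Phi>)}" "j \<in> {1..stages (direct_sum \<Psi> \<Phi>)}" "i \<le> j"
  have "rk_a \<Phi> (i - stages \<Psi>) (j - stages \<Psi>) = 0" if "i > stages \<Psi>"
    using that * assms(2)
    by (intro assms(2)[unfolded explicit_rk_def, rule_format]) (auto simp: direct_sum_def Let_def)
  moreover have "rk_a \<Psi> i j = 0" if "i \<le> stages \<Psi>" "j \<le> stages \<Psi>"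
    using that * by (intro assms(1)[unfolded explicit_rk_def, rule_format]) auto
  ultimately show "rk_a (direct_sum \<Psi> \<Phi>) i j = 0" by (simp add: direct_sum_def Let_def)
qed

lemma add_explicit_weights:
  assumes "f \<in> explicit_weights" "g \<in> explicit_weights"
  shows "(\<lambda>\<tau>. f \<tau> + g \<tau>) \<in> explicit_weights"
proof -
  obtain \<Psi> \<Phi> where *: "explicit_rk \<Psi>" "explicit_rk \<Phi>" "f = tree_weight \<Psi>" "g = tree_weight \<Phi>"
    using assms by (auto simp: explicit_weights_def)
  then have "(\<lambda>\<tau>. f \<tau> + g \<tau>) = tree_weight (direct_sum \<Psi> \<Phi>)"
    by (simp add: tree_weight_direct_sum fun_eq_iff)
  then show ?thesis using explicit_direct_sum[OF *(1,2)] by (auto simp: explicit_weights_def)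
qed

lemma sum_explicit_weights:
  "finite K \<Longrightarrow> (\<And>k. k \<in> K \<Longrightarrow> f k \<in> explicit_weights) \<Longrightarrow>
    (\<lambda>\<tau>. \<Sum>k\<in>K. f k \<tau>) \<in> explicit_weights"
  by (induction K rule: finite_induct) (simp_all add: zero_explicit_weights add_explicit_weights)

text \<open>
  The additional stage is the output of \<open>\<Psi>\<close>, so its stage weights are the elementary weights of
  \<open>\<Psi>\<close>. It is the only stage that enters the new output, with weight \<open>c\<close>.
\<close>

definition append_stage :: "real \<Rightarrow> rk_scheme \<Rightarrow> rk_scheme" where
  "append_stage c \<Psi> =
    (let s = stages \<Psi> in
     \<lparr>stages = Suc s,
      rk_a = (\<lambda>i j. if j > s then 0 else if i > s then rk_b \<Psi> j else rk_a \<Psi> i j),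
      rk_b = (\<lambda>i. if i > s then c else 0)\<rparr>)"

lemma append_stage_sel:
  "stages (append_stage c \<Psi>) = Suc (stages \<Psi>)"
  "i \<le> stages \<Psi> \<Longrightarrow> j \<le> stages \<Psi> \<Longrightarrow> rk_a (append_stage c \<Psi>) i j = rk_a \<Psi> i j"
  "j \<le> stages \<Psi> \<Longrightarrow> rk_a (append_stage c \<Psi>) (Suc (stages \<Psi>)) j = rk_b \<Psi> j"
  "rk_a (append_stage c \<Psi>) i (Suc (stages \<Psi>)) = 0"
  "i \<le> stages \<Psi> \<Longrightarrow> rk_b (append_stage c \<Psi>) i = 0"
  "rk_b (append_stage c \<Psi>) (Suc (stages \<Psi>)) = c"
  by (simp_all add: append_stage_def Let_def)

lemma explicit_append_stage: "explicit_rk \<Psi> \<Longrightarrow> explicit_rk (append_stage c \<Psi>)"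
  by (auto simp: explicit_rk_def append_stage_def Let_def)

lemma stage_weight_append_stage:
  "1 \<le> i \<Longrightarrow> i \<le> stages \<Psi> \<Longrightarrow> stage_weight (append_stage c \<Psi>) \<tau> i = stage_weight \<Psi> \<tau> i"
proof (induction \<tau> arbitrary: i)
  case (Node M)
  have "(\<Prod>\<tau>\<in>#M. stage_weight (append_stage c \<Psi>) \<tau> j) = (\<Prod>\<tau>\<in>#M. stage_weight \<Psi> \<tau> j)"
    if "j \<in> {1..stages \<Psi>}" for j
    using Node.IH that by (intro arg_cong[where f = prod_mset] image_mset_cong) auto
  then have "(\<Sum>j = 1..stages \<Psi>. rk_a (append_stage c \<Psi>) i j *
        (\<Prod>\<tau>\<in>#M. stage_weight (append_stage c \<Psi>) \<tau> j)) =
      (\<Sum>j = 1..stages \<Psi>. rk_a \<Psi> i j * (\<Prod>\<tau>\<in>#M. stage_weight \<Psi> \<tau> j))"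
    using Node.prems by (intro sum.cong refl) (simp add: append_stage_sel)
  then show ?case
    by (simp add: append_stage_sel)
qed

lemma last_stage_weight_append_stage:
  "stage_weight (append_stage c \<Psi>) \<tau> (Suc (stages \<Psi>)) = tree_weight \<Psi> \<tau>"
proof (cases \<tau>)
  case (Node M)
  have "(\<Prod>\<tau>\<in>#M. stage_weight (append_stage c \<Psi>) \<tau> j) = (\<Prod>\<tau>\<in>#M. stage_weight \<Psi> \<tau> j)"
    if "j \<in> {1..stages \<Psi>}" for j
    using that by (intro arg_cong[where f = prod_mset] image_mset_cong) (auto simp: stage_weight_append_stage)
  then have "(\<Sum>j = 1..stages \<Psi>. rk_a (append_stage c \<Psi>) (Suc (stages \<Psi>)) j *
        (\<Prod>\<tau>\<in>#M. stage_weight (append_stage c \<Psi>) \<tau> j)) =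
      (\<Sum>j = 1..stages \<Psi>. rk_b \<Psi> j * (\<Prod>\<tau>\<in>#M. stage_weight \<Psi> \<tau> j))"
    by (intro sum.cong refl) (simp add: append_stage_sel)
  then show ?thesis
    by (simp add: Node append_stage_sel)
qed

lemma tree_weight_append_stage:
  "tree_weight (append_stage c \<Psi>) (Node M) = c * (\<Prod>\<tau>\<in>#M. tree_weight \<Psi> \<tau>)"
proof -
  have "(\<Sum>i = 1..stages \<Psi>. rk_b (append_stage c \<Psi>) i *
      (\<Prod>\<tau>\<in>#M. stage_weight (append_stage c \<Psi>) \<tau> i)) = 0"
    by (intro sum.neutral) (simp add: append_stage_sel)
  then show ?thesis by (simp add: append_stage_sel last_stage_weight_append_stage)
qed

text \<open>
  Newton interpolation: a multiple of \<open>\<Prod>z\<in>S. (x - z)\<close> corrects the value at a new node without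
  changing the old ones.
\<close>

lemma ex_interpolation_poly:
  fixes f :: "'a::field \<Rightarrow> 'a"
  assumes "finite S"
  shows "\<exists>p. \<forall>x\<in>S. poly p x = f x"
  using assms
proof (induction S rule: finite_induct)
  case (insert y S)
  then obtain p where p: "\<forall>x\<in>S. poly p x = f x" by blast
  define w where "w = (\<Prod>z\<in>S. [:- z, 1:])"
  have w: "poly w x = (\<Prod>z\<in>S. x - z)" for x by (simp add: w_def poly_prod)
  have "poly w y \<noteq> 0" using insert.hyps by (auto simp: w)
  moreover have "poly w x = 0" if "x \<in> S" for x using insert.hyps that by (auto simp: w)
  ultimately have "\<forall>x\<in>insert y S. poly (p + smult ((f y - poly p y) / poly w y) w) x = f x"
    using p by simp
  then show ?case by blast
qed simp

text \<open>
  Label the elements of \<open>T\<close> by distinct primes and use unique factorisation.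
\<close>

lemma ex_separating_labels:
  fixes T :: "'a set"
  assumes "finite T"
  obtains x :: "'a \<Rightarrow> nat" where
    "\<And>M M'. set_mset M \<subseteq> T \<Longrightarrow> set_mset M' \<subseteq> T \<Longrightarrow>
      \<Prod>\<^sub># (image_mset x M) = \<Prod>\<^sub># (image_mset x M') \<Longrightarrow> M = M'"
proof -
  obtain Q :: "nat set" where Q: "finite Q" "card Q = card T" "Q \<subseteq> {p. prime p}"
    using infinite_arbitrarily_large[OF primes_infinite] by blast
  then obtain x where x: "bij_betw x T Q"
    using finite_same_card_bij[OF assms Q(1)] by auto
  have prime: "prime (x t)" if "t \<in> T" for t
    using that x Q(3) by (auto simp: bij_betw_def)
  have M: "M = image_mset (inv_into T x) (prime_factorization (\<Prod>\<^sub># (image_mset x M)))"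
    if "set_mset M \<subseteq> T" for M
  proof -
    have "prime_factorization (\<Prod>\<^sub># (image_mset x M)) = image_mset x M"
      using that prime by (intro prime_factorization_prod_mset_primes) auto
    then have "image_mset (inv_into T x) (prime_factorization (\<Prod>\<^sub># (image_mset x M))) =
        image_mset (\<lambda>t. inv_into T x (x t)) M" by (simp add: multiset.map_comp comp_def)
    also have "\<dots> = image_mset (\<lambda>t. t) M"
      using that x by (intro image_mset_cong inv_into_f_f) (auto simp: bij_betw_def)
    finally show ?thesis by simp
  qed
  show ?thesis
  proof (rule that[of x])
    fix M M' assume "set_mset M \<subseteq> T" "set_mset M' \<subseteq> T"
      "\<Prod>\<^sub># (image_mset x M) = \<Prod>\<^sub># (image_mset x M')"
    then show "M = M'" using M by metis
  qed
qed

text \<open>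
  Let the label \<open>x \<tau>\<close> separate forests of small trees by their products \<open>node M\<close>. By induction
  some scheme has the weights \<open>(x \<tau>)\<^bsup>k\<^esup>\<close> on small trees; appending a stage to it yields the weights
  \<open>c * (node M)\<^bsup>k\<^esup>\<close> on \<open>Node M\<close>. Summing over \<open>k\<close> gives \<open>p (node M)\<close> for any polynomial \<open>p\<close>, and since
  the nodes are distinct, \<open>p\<close> can be chosen by interpolation.
\<close>

theorem ex_explicit_weights:
  fixes g :: "rtree \<Rightarrow> real"
  shows "\<exists>f\<in>explicit_weights. \<forall>\<tau>. vertices \<tau> \<le> N \<longrightarrow> f \<tau> = g \<tau>"
proof (induction N arbitrary: g)
  case 0
  then show ?case using zero_explicit_weights by auto
next
  case (Suc N)
  let ?T = "{\<tau>. vertices \<tau> \<le> N}" and ?S = "{M. vertices (Node M) \<le> Suc N}"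
  have inT: "set_mset M \<subseteq> ?T" if "M \<in> ?S" for M
    using that vertices_le_forest_vertices order_trans by fastforce
  have finS: "finite ?S"
    using finite_vimageI[OF finite_trees[of "Suc N"], of Node] by (simp add: vimage_def inj_def)
  obtain x :: "rtree \<Rightarrow> nat" where sep: "\<And>M M'. set_mset M \<subseteq> ?T \<Longrightarrow> set_mset M' \<subseteq> ?T \<Longrightarrow>
      \<Prod>\<^sub># (image_mset x M) = \<Prod>\<^sub># (image_mset x M') \<Longrightarrow> M = M'"
    using ex_separating_labels[OF finite_trees[of N]] by blast
  define node where "node M = real (\<Prod>\<^sub># (image_mset x M))" for M
  have inj: "inj_on node ?S"
    using sep inT by (intro inj_onI) (simp add: node_def)
  obtain p where p: "\<forall>y\<in>node ` ?S. poly p y = g (Node (inv_into ?S node y))"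
    using ex_interpolation_poly[OF finite_imageI[OF finS, of node],
        of "\<lambda>y. g (Node (inv_into ?S node y))"] by (rule exE)
  have p: "poly p (node M) = g (Node M)" if "M \<in> ?S" for M
    using p that inv_into_f_f[OF inj that] by force
  have "\<exists>f\<in>explicit_weights. \<forall>M\<in>?S. f (Node M) = coeff p k * node M ^ k" for k
  proof -
    obtain \<Psi> where \<Psi>: "explicit_rk \<Psi>" "\<And>\<tau>. \<tau> \<in> ?T \<Longrightarrow> tree_weight \<Psi> \<tau> = real (x \<tau>) ^ k"
      using Suc.IH[of "\<lambda>\<tau>. real (x \<tau>) ^ k"] by (auto simp: explicit_weights_def)
    have "tree_weight (append_stage (coeff p k) \<Psi>) (Node M) = coeff p k * node M ^ k"
      if "M \<in> ?S" for M
    proof -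
      have "image_mset (tree_weight \<Psi>) M = image_mset (\<lambda>\<tau>. real (x \<tau>) ^ k) M"
        using inT[OF that] \<Psi>(2) by (intro image_mset_cong) blast
      moreover have "(\<Prod>\<tau>\<in>#M. real (x \<tau>) ^ k) = node M ^ k"
        unfolding node_def by (induction M) (simp_all add: power_mult_distrib)
      ultimately show ?thesis unfolding tree_weight_append_stage by simp
    qed
    then show ?thesis
      using explicit_append_stage[OF \<Psi>(1)] unfolding explicit_weights_def by blast
  qed
  then obtain f where f: "\<And>k. f k \<in> explicit_weights"
    "\<And>k M. M \<in> ?S \<Longrightarrow> f k (Node M) = coeff p k * node M ^ k"
    by metis
  show ?case
  proof (intro bexI allI impI)
    show "(\<lambda>\<tau>. \<Sum>k\<le>degree p. f k \<tau>) \<in> explicit_weights"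
      by (rule sum_explicit_weights) (simp_all add: f)
    fix \<tau> assume \<tau>: "vertices \<tau> \<le> Suc N"
    obtain M where M: "\<tau> = Node M" by (cases \<tau>)
    then have "M \<in> ?S" using \<tau> by simp
    then show "(\<Sum>k\<le>degree p. f k \<tau>) = g \<tau>"
      using p[of M] f(2)[of M] by (simp add: M poly_altdef)
  qed
qed


section \<open>Existence\<close>

lemma ex_tree: "\<exists>\<tau>. vertices \<tau> = Suc k"
proof (induction k)
  case 0
  have "vertices (Node {#}) = Suc 0" by simp
  then show ?case ..
next
  case (Suc k)
  then obtain \<tau> where "vertices \<tau> = Suc k" ..
  then have "vertices (Node {#\<tau>#}) = Suc (Suc k)" by simp
  then show ?case ..
qed

lemma Sup_enat_eq:
  assumes "P n" "\<And>k. P k \<Longrightarrow> k \<le> n"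
  shows "Sup {enat k | k. P k} = enat n"
  using assms by (intro antisym Sup_least Sup_upper) auto

theorem theorem8p3:
  fixes n m :: nat
  assumes "even n" and "n > 0" and "odd m" and "m > n"
  shows "\<exists>\<Psi>. \<Psi> \<in> EES n m"
proof -
  let ?exact = "\<lambda>\<tau>. 1 / real (tree_fact \<tau>)"
  obtain g where
    g_odd: "\<forall>\<tau>. odd (vertices \<tau>) \<longrightarrow> g \<tau> = ?exact \<tau> + (if vertices \<tau> = n + 1 then 1 else 0)" and
    g_even: "\<forall>\<tau>. even (vertices \<tau>) \<longrightarrow>
      plus_part (alg_ext g) (tree \<tau>) = (if vertices \<tau> = m + 1 then 1 else 0)"
    using ex_character_with_plus_part[of "\<lambda>\<tau>. ?exact \<tau> + (if vertices \<tau> = n + 1 then 1 else 0)"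
          "\<lambda>\<tau>. if vertices \<tau> = m + 1 then 1 else 0"] by blast
  \<comment> \<open>\<open>n + 1\<close> and \<open>m + 1\<close> both exceed \<open>n\<close>, so neither perturbation is felt yet.\<close>
  have g_exact: "g \<tau> = ?exact \<tau>" if "vertices \<tau> \<le> n" for \<tau>
    by (rule symmetric_order_conditions[OF _ _ that]) (use g_odd g_even assms in auto)
  obtain \<Psi> where expl: "explicit_rk \<Psi>"
    and tw: "\<And>\<tau>. vertices \<tau> \<le> m + 1 \<Longrightarrow> tree_weight \<Psi> \<tau> = g \<tau>"
    using ex_explicit_weights[of "m + 1" g] by (auto simp: explicit_weights_def)
  let ?\<psi> = "elementary_weights \<Psi>"
  have hom: "unital_alg_hom ?\<psi>" by (simp add: elementary_weights_def alg_hom_alg_ext)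
  have \<psi>_tree: "?\<psi> (tree \<tau>) = g \<tau>" if "vertices \<tau> \<le> m + 1" for \<tau>
    using tw[OF that] by (simp add: elementary_weights_def)
  have \<psi>_plus: "?\<psi> (plus_map (tree \<tau>)) = (if vertices \<tau> = m + 1 then 1 else 0)"
    if "vertices \<tau> \<le> m + 1" for \<tau>
  \<comment> \<open>\<open>?\<psi>\<close> agrees with the target only up to size \<open>m + 1\<close>, which is all that these values depend on.\<close>
  proof (cases "even (vertices \<tau>)")
    case True
    have "agree_below (vertices \<tau>) ?\<psi> (alg_ext g)"
      using that by (simp add: agree_below_def \<psi>_tree)
    from plus_part_diff[OF hom alg_hom_alg_ext True this]
    show ?thesis using g_even True that by (simp add: \<psi>_tree plus_part_def)
  next
    case False
    then show ?thesis
      using plus_part_odd[OF hom False] assms(3) by (auto simp: plus_part_def)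
  qed
  have "consistent_rk \<Psi>"
  proof -
    have "tree_weight \<Psi> (Node {#}) = ?exact (Node {#})"
      using g_exact[of "Node {#}"] tw[of "Node {#}"] assms by simp
    then show ?thesis by (simp add: consistent_rk_def)
  qed
  moreover have "rk_order ?\<psi> = enat n"
    unfolding rk_order_def
  proof (rule Sup_enat_eq)
    show "?\<psi> 1 = 1 \<and> (\<forall>\<tau>. vertices \<tau> \<le> n \<longrightarrow> ?\<psi> (tree \<tau>) = ?exact \<tau>)"
      using assms by (simp add: alg_hom_one[OF hom] \<psi>_tree g_exact)
    fix k assume k: "?\<psi> 1 = 1 \<and> (\<forall>\<tau>. vertices \<tau> \<le> k \<longrightarrow> ?\<psi> (tree \<tau>) = ?exact \<tau>)"
    obtain \<tau> where \<tau>: "vertices \<tau> = Suc n" using ex_tree by blast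
    then have "?\<psi> (tree \<tau>) \<noteq> ?exact \<tau>" using assms by (simp add: \<psi>_tree g_odd)
    then show "k \<le> n" using k \<tau> by (metis not_less_eq_eq)
  qed
  moreover have "antisym_order ?\<psi> = enat m"
    unfolding antisym_order_def
  proof (rule Sup_enat_eq)
    show "\<forall>\<tau>. vertices \<tau> \<le> m \<longrightarrow> ?\<psi> (plus_map (tree \<tau>)) = 0"
      by (simp add: \<psi>_plus)
    fix k assume k: "\<forall>\<tau>. vertices \<tau> \<le> k \<longrightarrow> ?\<psi> (plus_map (tree \<tau>)) = 0"
    obtain \<tau> where \<tau>: "vertices \<tau> = Suc m" using ex_tree by blast
    then have "?\<psi> (plus_map (tree \<tau>)) \<noteq> 0" by (simp add: \<psi>_plus)
    then show "k \<le> m" using k \<tau> by (metis not_less_eq_eq)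
  qed
  ultimately show ?thesis using expl by (auto simp: EES_def)
qed

end
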